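(* Let $(M,e)$ be an $\mathrm H$-extensional $\mathcal L_e$-structure such that $(M,d_e)$ is a complete metric space. Let $E_e=\{(x,y)\in M^2: e(x,y)=0\}$. Then $(M,d_e,E_e)$ is a model of $\mathsf{MSE}$ if and only if $(M,e)$ satisfies $\mathcal L_e$-excision. Furthermore, all models of $\mathsf{MSE}$ arise in this manner.
   Context: Metric set structures. For a metric space $(M,d)$ with $[0,1]$-valued metric and $A,B\subseteq M$, $d_{\mathrm H}(A,B)$ is the $[0,1]$-valued Hausdorff distance: the least $t\in[0,1]$ such that for every $r>t$ each point of $A$ is at distance $<r$ from some point of $B$ and vice versa; by convention $d_{\mathrm H}(\varnothing,\varnothing)=0$ and $d_{\mathrm H}(\varnothing,A)=1$ for $A\neq\varnothing$. A metric set structure is a triple $(M,d,E)$ with $(M,d)$ a (nonempty) complete metric space, $d$ $[0,1]$-valued, and $E\subseteq M^2$ a closed binary relation with $d(a,b)=d_{\mathrm H}(\{x:x\,E\,a\},\{x:x\,E\,b\})$ for all $a,b\in M$. $\mathsf{MSE}$-formulas are the smallest collection of expressions containing $1$ and $d(x,y)$ ($x,y$ variables) and closed under $\varphi+\psi$, $\max(\varphi,\psi)$, $\min(\varphi,\psi)$, $r\cdot\varphi$ ($r\in\mathbb R$), $\sup_x\varphi$, $\inf_x\varphi$, $\sup_{x E y}\varphi$, $\inf_{x E y}\varphi$. Put $v(1)=v(d(x,y))=1$, $v(\varphi+\psi)=v(\varphi)+v(\psi)$, $v(\max(\varphi,\psi))=v(\min(\varphi,\psi))=\max(v(\varphi),v(\psi))$,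 $v(r\varphi)=|r|v(\varphi)$, and quantifiers do not change $v$. The real value $\varphi^M(\bar a)$ is defined in the obvious way (bounded quantifiers range over $\{x: x\,E\,a\}$), except that if no $x$ satisfies $x\,E\,a$ then $\sup_{xEa}\varphi$ has value $-v(\varphi)$ and $\inf_{xEa}\varphi$ has value $v(\varphi)$. $(M,d,E)$ is a model of $\mathsf{MSE}$ if it is a metric set structure satisfying excision: for every $\mathsf{MSE}$-formula $\varphi(x,\bar y)$, reals $r<s$ and $\bar a\in M$ there is $b\in M$ such that for all $c\in M$: $\varphi^M(c,\bar a)\le r$ implies $c\,E\,b$, and $c\,E\,b$ implies $\varphi^M(c,\bar a)<s$. $\mathcal L_e$-structures. An $\mathcal L_e$-structure is a nonempty set $M$ with a function $e:M^2\to[0,1]$. Put $d_e(x,y)=\sup_{z\in M}|e(z,x)-e(z,y)|$, a pseudo-metric. $(M,e)$ is $\mathrm H$-extensional if $e(x,y)=\inf_{z\in M}\min(d_e(x,z)+2e(z,y),1)$ for all $x,y\in M$. Restricted $\mathcal L_e$-formulas are built from atomic formulas $e(x,y)$ and the constant $1$ using $\varphi+\psi$, $\max$, $\min$, $r\cdot\varphi$ with $r\in\mathbb Q$, $\sup_x$ and $\inf_x$ (evaluated over $M$ in the obvious way). For these, $v(1)=v(e(x,y))=1$, $v(\varphi+\psi)=v(\varphi)+v(\psi)$, $v(\max(\varphi,\psi))=v(\min(\varphi,\psi))=\max(v(\varphi),v(\psi))$, $v(r\cdot\varphi)=|r|v(\varphi)$, and $v(\sup_x\varphi)=v(\inf_x\varphi)=v(\varphi)$;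 $\varepsilon_\varphi=\dfrac{1}{\max(6v(\varphi),3)}$. $(M,e)$ satisfies $\mathcal L_e$-excision if for every restricted $\mathcal L_e$-formula $\varphi(x,\bar y)$ (not containing $z$ free), $$\sup_{\bar y}\inf_z\sup_x\max\bigl(\min(e(x,z),-\varphi(x,\bar y)),\ \min(\varepsilon_\varphi-e(x,z),\varphi(x,\bar y)-1)\bigr)\le 0$$ holds in $(M,e)$. "All models of $\mathsf{MSE}$ arise in this manner" means: for every model $(M,d,E)$ of $\mathsf{MSE}$, setting $e(x,y)=\inf\{d(x,z):z\,E\,y\}$ (with $\inf\varnothing=1$), $(M,e)$ is an $\mathrm H$-extensional $\mathcal L_e$-structure satisfying $\mathcal L_e$-excision with $d_e=d$ and $E_e=E$. *)

theory Defs
  imports "HOL-Analysis.Analysis"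
begin

section \<open>Metric set structures\<close>

definition hausdorff_dist :: "('a \<Rightarrow> 'a \<Rightarrow> real) \<Rightarrow> 'a set \<Rightarrow> 'a set \<Rightarrow> real" where
  "hausdorff_dist d A B =
    (if A = {} \<and> B = {} then 0
     else if A = {} \<or> B = {} then 1
     else (LEAST t. 0 \<le> t \<and> t \<le> 1 \<and>
             (\<forall>r>t. (\<forall>a\<in>A. \<exists>b\<in>B. d a b < r) \<and> (\<forall>b\<in>B. \<exists>a\<in>A. d b a < r))))"

definition extension :: "('a \<times> 'a) set \<Rightarrow> 'a \<Rightarrow> 'a set" where
  "extension E a = {x. (x, a) \<in> E}"

definition metric_set_structure ::
    "'a set \<Rightarrow> ('a \<Rightarrow> 'a \<Rightarrow> real) \<Rightarrow> ('a \<times> 'a) set \<Rightarrow> bool" where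
  "metric_set_structure M d E \<longleftrightarrow>
     M \<noteq> {} \<and> Metric_space M d \<and> Metric_space.mcomplete M d \<and>
     (\<forall>x\<in>M. \<forall>y\<in>M. d x y \<le> 1) \<and>
     closedin (prod_topology (Metric_space.mtopology M d) (Metric_space.mtopology M d)) E \<and>
     (\<forall>a\<in>M. \<forall>b\<in>M. d a b = hausdorff_dist d (extension E a) (extension E b))"

section \<open>MSE-formulas\<close>

text \<open>Variables are natural numbers. In \<open>MSupIn x y \<phi>\<close> and \<open>MInfIn x y \<phi>\<close> (bounded quantifiers
  over \<open>x E y\<close>) the bound \<open>y\<close> lies outside the scope of the quantified \<open>x\<close>, so the
  degenerate case \<open>x = y\<close> is just an alphabetic variant of a formula with \<open>x \<noteq> y\<close>.\<close>

datatype mse_fm =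
    MOne
  | MDist nat nat
  | MAdd mse_fm mse_fm
  | MMax mse_fm mse_fm
  | MMin mse_fm mse_fm
  | MScale real mse_fm
  | MSup nat mse_fm
  | MInf nat mse_fm
  | MSupIn nat nat mse_fm
  | MInfIn nat nat mse_fm

primrec mse_v :: "mse_fm \<Rightarrow> real" where
  "mse_v MOne = 1"
| "mse_v (MDist x y) = 1"
| "mse_v (MAdd \<phi> \<psi>) = mse_v \<phi> + mse_v \<psi>"
| "mse_v (MMax \<phi> \<psi>) = max (mse_v \<phi>) (mse_v \<psi>)"
| "mse_v (MMin \<phi> \<psi>) = max (mse_v \<phi>) (mse_v \<psi>)"
| "mse_v (MScale r \<phi>) = \<bar>r\<bar> * mse_v \<phi>"
| "mse_v (MSup x \<phi>) = mse_v \<phi>"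
| "mse_v (MInf x \<phi>) = mse_v \<phi>"
| "mse_v (MSupIn x y \<phi>) = mse_v \<phi>"
| "mse_v (MInfIn x y \<phi>) = mse_v \<phi>"

primrec mse_val ::
    "'a set \<Rightarrow> ('a \<Rightarrow> 'a \<Rightarrow> real) \<Rightarrow> ('a \<times> 'a) set \<Rightarrow> mse_fm \<Rightarrow> (nat \<Rightarrow> 'a) \<Rightarrow> real" where
  "mse_val M d E MOne \<rho> = 1"
| "mse_val M d E (MDist x y) \<rho> = d (\<rho> x) (\<rho> y)"
| "mse_val M d E (MAdd \<phi> \<psi>) \<rho> = mse_val M d E \<phi> \<rho> + mse_val M d E \<psi> \<rho>"
| "mse_val M d E (MMax \<phi> \<psi>) \<rho> = max (mse_val M d E \<phi> \<rho>) (mse_val M d E \<psi> \<rho>)"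
| "mse_val M d E (MMin \<phi> \<psi>) \<rho> = min (mse_val M d E \<phi> \<rho>) (mse_val M d E \<psi> \<rho>)"
| "mse_val M d E (MScale r \<phi>) \<rho> = r * mse_val M d E \<phi> \<rho>"
| "mse_val M d E (MSup x \<phi>) \<rho> = (SUP a\<in>M. mse_val M d E \<phi> (\<rho>(x := a)))"
| "mse_val M d E (MInf x \<phi>) \<rho> = (INF a\<in>M. mse_val M d E \<phi> (\<rho>(x := a)))"
| "mse_val M d E (MSupIn x y \<phi>) \<rho> =
     (if extension E (\<rho> y) = {} then - mse_v \<phi>
      else (SUP a\<in>extension E (\<rho> y). mse_val M d E \<phi> (\<rho>(x := a))))"
| "mse_val M d E (MInfIn x y \<phi>) \<rho> =
     (if extension E (\<rho> y) = {} then mse_v \<phi>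
      else (INF a\<in>extension E (\<rho> y). mse_val M d E \<phi> (\<rho>(x := a))))"

text \<open>The parameters of the excised formula are supplied by a valuation \<open>\<rho>\<close> into \<open>M\<close>; the
  excision variable is an arbitrary variable \<open>x\<close>.\<close>

definition mse_excision ::
    "'a set \<Rightarrow> ('a \<Rightarrow> 'a \<Rightarrow> real) \<Rightarrow> ('a \<times> 'a) set \<Rightarrow> bool" where
  "mse_excision M d E \<longleftrightarrow>
     (\<forall>\<phi> x r s \<rho>. r < s \<longrightarrow> range \<rho> \<subseteq> M \<longrightarrow>
        (\<exists>b\<in>M. \<forall>c\<in>M.
           (mse_val M d E \<phi> (\<rho>(x := c)) \<le> r \<longrightarrow> (c, b) \<in> E) \<and>
           ((c, b) \<in> E \<longrightarrow> mse_val M d E \<phi> (\<rho>(x := c)) < s)))"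

definition mse_model ::
    "'a set \<Rightarrow> ('a \<Rightarrow> 'a \<Rightarrow> real) \<Rightarrow> ('a \<times> 'a) set \<Rightarrow> bool" where
  "mse_model M d E \<longleftrightarrow> metric_set_structure M d E \<and> mse_excision M d E"

section \<open>Structures with a real-valued membership function\<close>

definition Le_structure :: "'a set \<Rightarrow> ('a \<Rightarrow> 'a \<Rightarrow> real) \<Rightarrow> bool" where
  "Le_structure M e \<longleftrightarrow> M \<noteq> {} \<and> (\<forall>x\<in>M. \<forall>y\<in>M. 0 \<le> e x y \<and> e x y \<le> 1)"

text \<open>The value \<open>0\<close> outside \<open>M\<close> is a dummy; it is needed because \<^locale>\<open>Metric_space\<close>
  asks for nonnegativity and symmetry on the whole type.\<close>

definition d_of :: "'a set \<Rightarrow> ('a \<Rightarrow> 'a \<Rightarrow> real) \<Rightarrow> 'a \<Rightarrow> 'a \<Rightarrow> real" where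
  "d_of M e x y = (if x \<in> M \<and> y \<in> M then (SUP z\<in>M. \<bar>e z x - e z y\<bar>) else 0)"

definition E_of :: "'a set \<Rightarrow> ('a \<Rightarrow> 'a \<Rightarrow> real) \<Rightarrow> ('a \<times> 'a) set" where
  "E_of M e = {(x, y). x \<in> M \<and> y \<in> M \<and> e x y = 0}"

definition e_of :: "('a \<Rightarrow> 'a \<Rightarrow> real) \<Rightarrow> ('a \<times> 'a) set \<Rightarrow> 'a \<Rightarrow> 'a \<Rightarrow> real" where
  "e_of d E x y = (if extension E y = {} then 1 else (INF z\<in>extension E y. d x z))"

definition H_extensional :: "'a set \<Rightarrow> ('a \<Rightarrow> 'a \<Rightarrow> real) \<Rightarrow> bool" where
  "H_extensional M e \<longleftrightarrow>
     (\<forall>x\<in>M. \<forall>y\<in>M. e x y = (INF z\<in>M. min (d_of M e x z + 2 * e z y) 1))"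

datatype le_fm =
    LOne
  | LMem nat nat
  | LAdd le_fm le_fm
  | LMax le_fm le_fm
  | LMin le_fm le_fm
  | LScale rat le_fm
  | LSup nat le_fm
  | LInf nat le_fm

primrec le_v :: "le_fm \<Rightarrow> real" where
  "le_v LOne = 1"
| "le_v (LMem x y) = 1"
| "le_v (LAdd \<phi> \<psi>) = le_v \<phi> + le_v \<psi>"
| "le_v (LMax \<phi> \<psi>) = max (le_v \<phi>) (le_v \<psi>)"
| "le_v (LMin \<phi> \<psi>) = max (le_v \<phi>) (le_v \<psi>)"
| "le_v (LScale q \<phi>) = \<bar>of_rat q\<bar> * le_v \<phi>"
| "le_v (LSup x \<phi>) = le_v \<phi>"
| "le_v (LInf x \<phi>) = le_v \<phi>"

primrec le_val :: "'a set \<Rightarrow> ('a \<Rightarrow> 'a \<Rightarrow> real) \<Rightarrow> le_fm \<Rightarrow> (nat \<Rightarrow> 'a) \<Rightarrow> real" where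
  "le_val M e LOne \<rho> = 1"
| "le_val M e (LMem x y) \<rho> = e (\<rho> x) (\<rho> y)"
| "le_val M e (LAdd \<phi> \<psi>) \<rho> = le_val M e \<phi> \<rho> + le_val M e \<psi> \<rho>"
| "le_val M e (LMax \<phi> \<psi>) \<rho> = max (le_val M e \<phi> \<rho>) (le_val M e \<psi> \<rho>)"
| "le_val M e (LMin \<phi> \<psi>) \<rho> = min (le_val M e \<phi> \<rho>) (le_val M e \<psi> \<rho>)"
| "le_val M e (LScale q \<phi>) \<rho> = of_rat q * le_val M e \<phi> \<rho>"
| "le_val M e (LSup x \<phi>) \<rho> = (SUP a\<in>M. le_val M e \<phi> (\<rho>(x := a)))"
| "le_val M e (LInf x \<phi>) \<rho> = (INF a\<in>M. le_val M e \<phi> (\<rho>(x := a)))"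

definition le_eps :: "le_fm \<Rightarrow> real" where
  "le_eps \<phi> = 1 / max (6 * le_v \<phi>) 3"

text \<open>The valuation \<open>\<rho>\<close> ranges over the parameters. The value \<open>c\<close> of the variable \<open>z\<close> is
  not entered into the valuation, which expresses that \<open>z\<close> is not free in \<open>\<phi>\<close>.\<close>

definition Le_excision :: "'a set \<Rightarrow> ('a \<Rightarrow> 'a \<Rightarrow> real) \<Rightarrow> bool" where
  "Le_excision M e \<longleftrightarrow>
     (\<forall>\<phi> x.
        (SUP \<rho>\<in>{\<rho>. range \<rho> \<subseteq> M}. INF c\<in>M. SUP a\<in>M.
           max (min (e a c) (- le_val M e \<phi> (\<rho>(x := a))))
               (min (le_eps \<phi> - e a c) (le_val M e \<phi> (\<rho>(x := a)) - 1))) \<le> 0)"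

end

theory Submission
  imports Defs
begin

text \<open>
The two kinds of structures carry the same information: a set is determined by its distance
function, the Hausdorff distance of two sets is the uniform distance of their distance functions
(\<open>hausdorff_dist_extension\<close>), and \<open>H\<close>-extensionality together with completeness says exactly that
\<open>e x y\<close> is the distance from \<open>x\<close> to the zero set of \<open>e(\<cdot>, y)\<close>
(\<open>H_extensional_imp_membership_structure\<close>). The locale \<open>membership_structure\<close> collects the resulting
relations between \<open>d\<close>, \<open>E\<close> and \<open>e\<close>. Both parts of the theorem lead to this locale, so it remains to
compare the two forms of excision inside it.

One direction rests on the fact that every formula is Lipschitz with constant \<open>2 * v\<close>
(\<open>lipschitz_value_mse_val\<close>). Since \<open>e(x, y)\<close> is the bounded infimum of \<open>d(x, z)\<close> over \<open>z E y\<close>,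
membership formulas translate into MSE-formulas, and a set excised between the levels \<open>0\<close> and
\<open>2 / 3\<close> stays clear of the points of value above \<open>1\<close> by the distance \<open>\<epsilon>\<close>.

For the converse, MSE-formulas are uniform limits of membership formulas
(\<open>approximable_mse_val\<close>). The metric is a supremum of differences of \<open>e\<close>, and by Lipschitz continuity
a bounded supremum over \<open>z E y\<close> is an unbounded one with a multiple of \<open>e(z, y)\<close> subtracted as a
penalty. Excision for membership formulas then yields a set that contains the wanted sublevel set up
to an arbitrarily small error (\<open>Le_excision_separates\<close>). The error is removed by repeatedly excising
neighbourhoods of the set just obtained, with errors decreasing geometrically, and passing to
the limit (\<open>Le_excision_thickening\<close>). The limit set is close to the first set, so by Lipschitz
continuity it still avoids the points of large value.
\<close>

section \<open>Suprema and Lipschitz estimates over the reals\<close>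

lemma INF_eq_minus_SUP: "(INF a\<in>A. f a) = - (SUP a\<in>A. - f a :: real)"
  by (simp add: Inf_real_def image_image)

lemma abs_SUP_le:
  fixes f :: "'a \<Rightarrow> real"
  assumes "A \<noteq> {}" and b: "\<And>a. a \<in> A \<Longrightarrow> \<bar>f a\<bar> \<le> v"
  shows "\<bar>SUP a\<in>A. f a\<bar> \<le> v"
proof -
  obtain a where a: "a \<in> A" using assms by blast
  have "bdd_above (f ` A)" using b by (intro bdd_aboveI[of _ v]) (auto simp: abs_le_iff)
  then have "f a \<le> (SUP a\<in>A. f a)" using a by (rule cSUP_upper2[OF _ _ order_refl])
  moreover have "(SUP a\<in>A. f a) \<le> v"
    using assms by (intro cSUP_least) (auto simp: abs_le_iff)
  moreover have "- v \<le> f a" using b[OF a] by linarith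
  ultimately show ?thesis by linarith
qed

lemma abs_INF_le:
  fixes f :: "'a \<Rightarrow> real"
  assumes "A \<noteq> {}" "\<And>a. a \<in> A \<Longrightarrow> \<bar>f a\<bar> \<le> v"
  shows "\<bar>INF a\<in>A. f a\<bar> \<le> v"
  using abs_SUP_le[of A "\<lambda>a. - f a" v] assms by (simp add: INF_eq_minus_SUP)

lemma SUP_le_SUP_plus:
  fixes f g :: "_ \<Rightarrow> real"
  assumes "A \<noteq> {}" and g: "\<And>b. b \<in> B \<Longrightarrow> \<bar>g b\<bar> \<le> v"
    and *: "\<And>a. a \<in> A \<Longrightarrow> \<exists>b\<in>B. f a \<le> g b + t"
  shows "(SUP a\<in>A. f a) \<le> (SUP b\<in>B. g b) + t"
proof (rule cSUP_least[OF \<open>A \<noteq> {}\<close>])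
  fix a assume "a \<in> A"
  then obtain b where b: "b \<in> B" "f a \<le> g b + t" using * by blast
  have "bdd_above (g ` B)" using g by (intro bdd_aboveI[of _ v]) (auto simp: abs_le_iff)
  then have "g b \<le> (SUP b\<in>B. g b)" using b(1) by (rule cSUP_upper2[OF _ _ order_refl])
  with b(2) show "f a \<le> (SUP b\<in>B. g b) + t" by linarith
qed

lemma abs_SUP_diff_le:
  fixes f g :: "_ \<Rightarrow> real"
  assumes "A \<noteq> {}" "B \<noteq> {}"
    and "\<And>a. a \<in> A \<Longrightarrow> \<bar>f a\<bar> \<le> v" "\<And>b. b \<in> B \<Longrightarrow> \<bar>g b\<bar> \<le> w"
    and "\<And>a. a \<in> A \<Longrightarrow> \<exists>b\<in>B. \<bar>f a - g b\<bar> \<le> t" "\<And>b. b \<in> B \<Longrightarrow> \<exists>a\<in>A. \<bar>f a - g b\<bar> \<le> t"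
  shows "\<bar>(SUP a\<in>A. f a) - (SUP b\<in>B. g b)\<bar> \<le> t"
proof -
  have "(SUP a\<in>A. f a) \<le> (SUP b\<in>B. g b) + t"
  proof (rule SUP_le_SUP_plus[OF assms(1,4)])
    show "\<exists>b\<in>B. f a \<le> g b + t" if "a \<in> A" for a
      using assms(5)[OF that] by (auto simp: abs_le_iff algebra_simps)
  qed
  moreover have "(SUP b\<in>B. g b) \<le> (SUP a\<in>A. f a) + t"
  proof (rule SUP_le_SUP_plus[OF assms(2,3)])
    show "\<exists>a\<in>A. g b \<le> f a + t" if "b \<in> B" for b
      using assms(6)[OF that] by (auto simp: abs_le_iff algebra_simps)
  qed
  ultimately show ?thesis by linarith
qed

lemma abs_max_diff_le:
  fixes a b a' b' t :: real
  assumes "\<bar>a - a'\<bar> \<le> t" "\<bar>b - b'\<bar> \<le> t"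
  shows "\<bar>max a b - max a' b'\<bar> \<le> t" "\<bar>min a b - min a' b'\<bar> \<le> t"
  using assms by linarith+

lemma abs_max_le:
  fixes a b v :: real
  assumes "\<bar>a\<bar> \<le> v" "\<bar>b\<bar> \<le> v"
  shows "\<bar>max a b\<bar> \<le> v" "\<bar>min a b\<bar> \<le> v"
  using assms by linarith+

lemma le_scaled_max:
  fixes s v w t :: real
  assumes "0 \<le> t"
  shows "s \<le> 2 * v * t \<Longrightarrow> s \<le> 2 * max v w * t" "s \<le> 2 * w * t \<Longrightarrow> s \<le> 2 * max v w * t"
  using assms mult_right_mono[of "2 * v" "2 * max v w" t] mult_right_mono[of "2 * w" "2 * max v w" t]
  by linarith+

text \<open>Points of two extensions can only be matched at a distance strictly above the distance of the
two sets. Estimates proved for every such larger distance pass to the limit by this lemma.\<close>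
lemma le_scaled_if_le_above:
  fixes A c t :: real
  assumes "\<And>u. u > t \<Longrightarrow> A \<le> c * u" "c \<ge> 0"
  shows "A \<le> c * t"
proof (cases "c = 0")
  case True
  then show ?thesis using assms(1)[of "t + 1"] by simp
next
  case False
  with \<open>c \<ge> 0\<close> have "c > 0" by simp
  have "A / c \<le> t"
  proof (rule dense_ge)
    show "A / c \<le> u" if "u > t" for u
      using assms(1)[OF that] \<open>c > 0\<close> by (simp add: pos_divide_le_eq mult.commute)
  qed
  then show ?thesis using \<open>c > 0\<close> by (simp add: pos_divide_le_eq mult.commute)
qed

section \<open>Geometrically convergent iteration in a complete metric space\<close>

text \<open>Both limit constructions of the proof improve an approximate solution step by step: \<open>P x s\<close>
says that \<open>x\<close> solves the problem up to the error \<open>s\<close>, and halving the error costs a move of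
length at most \<open>c * s\<close>. The moves form a geometric series, so the iterates converge, and the
limit is at distance at most \<open>2 * c * t\<close> from the starting point.\<close>
lemma (in Metric_space) mcomplete_iteration:
  assumes "mcomplete" and p: "p \<in> M" "P p t" "t > 0" and "c \<ge> 0"
    and step: "\<And>x s. x \<in> M \<Longrightarrow> s > 0 \<Longrightarrow> P x s \<Longrightarrow> \<exists>y\<in>M. P y (s / 2) \<and> d x y \<le> c * s"
  obtains l where "l \<in> M" "d p l \<le> 2 * c * t"
    "\<And>\<eta>. \<eta> > 0 \<Longrightarrow> \<exists>x\<in>M. \<exists>s>0. s < \<eta> \<and> d x l < \<eta> \<and> P x s"
proof -
  define r where "r n = t / 2 ^ n" for n
  have r_pos: "r n > 0" and r_Suc: "r (Suc n) = r n / 2" for n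
    using \<open>t > 0\<close> by (simp_all add: r_def)
  have "\<exists>f. \<forall>n. (f n \<in> M \<and> P (f n) (r n) \<and> (n = 0 \<longrightarrow> f n = p)) \<and> d (f n) (f (Suc n)) \<le> c * r n"
  proof (rule dependent_nat_choice)
    show "\<exists>x. x \<in> M \<and> P x (r 0) \<and> (0 = (0::nat) \<longrightarrow> x = p)"
      using p by (auto simp: r_def)
    show "\<exists>y. (y \<in> M \<and> P y (r (Suc n)) \<and> (Suc n = 0 \<longrightarrow> y = p)) \<and> d x y \<le> c * r n"
      if "x \<in> M \<and> P x (r n) \<and> (n = 0 \<longrightarrow> x = p)" for x n
      using step[of x "r n"] that r_pos[of n] by (auto simp: r_Suc)
  qed
  then obtain f where f: "\<And>n. f n \<in> M" "\<And>n. P (f n) (r n)" "f 0 = p"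
    "\<And>n. d (f n) (f (Suc n)) \<le> c * r n" by blast
  \<comment> \<open>The exact partial sums of the geometric series make the induction on \<open>k\<close> go through.\<close>
  have far: "d (f n) (f (n + k)) \<le> 2 * c * r n - 2 * c * r (n + k)" for n k
  proof (induction k)
    case 0
    show ?case using f(1) by simp
  next
    case (Suc k)
    have "d (f n) (f (n + Suc k)) \<le> d (f n) (f (n + k)) + d (f (n + k)) (f (n + Suc k))"
      using f(1) by (intro triangle) auto
    also have "\<dots> \<le> 2 * c * r n - 2 * c * r (n + k) + c * r (n + k)"
      using Suc f(4)[of "n + k"] by simp
    also have "\<dots> = 2 * c * r n - 2 * c * r (n + Suc k)" by (simp add: r_Suc)
    finally show ?case .
  qed
  have far': "d (f n) (f m) \<le> 2 * c * r n" if "n \<le> m" for n m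
  proof -
    have "c * r m \<ge> 0" using r_pos[of m] \<open>c \<ge> 0\<close> by simp
    then show ?thesis using far[of n "m - n"] that by simp
  qed
  have r_lim: "r \<longlonglongrightarrow> 0"
    unfolding r_def using LIMSEQ_divide_realpow_zero[of 2 t] by simp
  then have cr_lim: "(\<lambda>n. 2 * c * r n) \<longlonglongrightarrow> 0" by (auto intro: tendsto_eq_intros)
  have "MCauchy f"
    unfolding MCauchy_def
  proof (intro conjI allI impI)
    show "range f \<subseteq> M" using f(1) by auto
    fix \<epsilon> :: real assume "\<epsilon> > 0"
    then have "\<forall>\<^sub>F n in sequentially. 2 * c * r n < \<epsilon>"
      using cr_lim by (simp add: order_tendstoD)
    then obtain N where N: "\<And>n. n \<ge> N \<Longrightarrow> 2 * c * r n < \<epsilon>"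
      by (auto simp: eventually_sequentially)
    show "\<exists>N. \<forall>n n'. N \<le> n \<longrightarrow> N \<le> n' \<longrightarrow> d (f n) (f n') < \<epsilon>"
    proof (intro exI[of _ N] allI impI)
      fix n n' assume "N \<le> n" "N \<le> n'"
      then show "d (f n) (f n') < \<epsilon>"
        using far'[of n n'] far'[of n' n] N[of n] N[of n'] commute[of "f n" "f n'"]
        by (cases "n \<le> n'") auto
    qed
  qed
  then obtain l where "limitin mtopology f l sequentially"
    using \<open>mcomplete\<close> by (auto simp: mcomplete_def)
  then have l: "l \<in> M" and lim: "\<And>\<epsilon>. \<epsilon> > 0 \<Longrightarrow> \<exists>N. \<forall>n\<ge>N. d (f n) l < \<epsilon>"
    by (simp_all add: limit_metric_sequentially) meson
  have "d p l \<le> 2 * c * t"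
  proof (rule field_le_epsilon)
    fix \<epsilon> :: real assume "\<epsilon> > 0"
    then obtain n where "d (f n) l < \<epsilon>" using lim by blast
    moreover have "d (f 0) l \<le> d (f 0) (f n) + d (f n) l" using f(1) l by (intro triangle)
    ultimately show "d p l \<le> 2 * c * t + \<epsilon>"
      using far'[of 0 n] f(3) by (simp add: r_def)
  qed
  moreover have "\<exists>x\<in>M. \<exists>s>0. s < \<eta> \<and> d x l < \<eta> \<and> P x s" if "\<eta> > 0" for \<eta>
  proof -
    obtain N where "\<And>n. n \<ge> N \<Longrightarrow> d (f n) l < \<eta>" using lim[OF \<open>\<eta> > 0\<close>] by blast
    moreover obtain N' where "\<And>n. n \<ge> N' \<Longrightarrow> r n < \<eta>"
      using order_tendstoD(2)[OF r_lim \<open>\<eta> > 0\<close>] by (auto simp: eventually_sequentially)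
    ultimately show ?thesis
      using f r_pos by (intro bexI[of _ "f (max N N')"] exI[of _ "r (max N N')"]) auto
  qed
  ultimately show thesis using that l by blast
qed

section \<open>Distance to the extension of a point\<close>

locale bounded_relation = Metric_space M d
  for M :: "'a set" and d :: "'a \<Rightarrow> 'a \<Rightarrow> real" +
  fixes E :: "('a \<times> 'a) set"
  assumes nonempty: "M \<noteq> {}"
    and d_le_1: "\<And>x y. x \<in> M \<Longrightarrow> y \<in> M \<Longrightarrow> d x y \<le> 1"
    and E_sub: "E \<subseteq> M \<times> M"
begin

lemma extension_sub: "extension E y \<subseteq> M"
  using E_sub by (auto simp: extension_def)

lemma e_of_empty: "extension E y = {} \<Longrightarrow> e_of d E x y = 1"
  by (simp add: e_of_def)

lemma e_of_le_d: "(z, y) \<in> E \<Longrightarrow> e_of d E x y \<le> d x z"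
  unfolding e_of_def extension_def by (auto intro!: cINF_lower2 bdd_belowI[of _ 0])

lemma le_e_of:
  assumes "t \<le> 1" "\<And>z. (z, y) \<in> E \<Longrightarrow> t \<le> d x z"
  shows "t \<le> e_of d E x y"
  using assms unfolding e_of_def extension_def by (auto intro!: cINF_greatest)

text \<open>A lower bound for a multiple of the distance to an extension may be tested on the members. The
premise \<open>t \<le> c\<close> is what the bound means when there are no members, where the distance is \<open>1\<close>.\<close>
lemma le_mult_e_of:
  assumes "0 \<le> c" "t \<le> c" "\<And>z. (z, y) \<in> E \<Longrightarrow> t \<le> c * d x z"
  shows "t \<le> c * e_of d E x y"
proof (cases "c = 0")
  case False
  then have "t / c \<le> e_of d E x y"
    using assms by (intro le_e_of) (auto simp: field_simps)
  then show ?thesis using False \<open>0 \<le> c\<close> by (simp add: field_simps)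
qed (use assms in auto)

lemma e_of_nonneg: "0 \<le> e_of d E x y"
  by (rule le_e_of) auto

lemma e_of_le_1: "x \<in> M \<Longrightarrow> e_of d E x y \<le> 1"
proof (cases "extension E y = {}")
  case False
  assume x: "x \<in> M"
  obtain z where "(z, y) \<in> E" using False by (auto simp: extension_def)
  then show ?thesis using e_of_le_d[of z y x] d_le_1[OF x, of z] E_sub by auto
qed (simp add: e_of_empty)

lemma e_of_less_witness:
  assumes "e_of d E x y < t" "t \<le> 1 \<or> extension E y \<noteq> {}"
  obtains z where "(z, y) \<in> E" "d x z < t"
proof (cases "\<exists>z. (z, y) \<in> E \<and> d x z < t")
  case False
  then have ne: "extension E y \<noteq> {} \<Longrightarrow> t \<le> e_of d E x y"
    unfolding e_of_def extension_def by (auto intro!: cINF_greatest simp: not_less)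
  show ?thesis
  proof (cases "extension E y = {}")
    case True
    then show ?thesis using assms e_of_empty[of y x] by auto
  qed (use ne assms in auto)
qed (use that in auto)

lemma e_of_triangle:
  assumes "x \<in> M" "z \<in> M"
  shows "e_of d E x y \<le> d x z + e_of d E z y"
proof -
  have "e_of d E x y - d x z \<le> e_of d E z y"
  proof (rule le_e_of)
    show "e_of d E x y - d x z \<le> 1"
      using e_of_le_1[OF \<open>x \<in> M\<close>, of y] nonneg[of x z] by linarith
    fix w assume w: "(w, y) \<in> E"
    then have "w \<in> M" using E_sub by auto
    then show "e_of d E x y - d x z \<le> d z w"
      using e_of_le_d[OF w, of x] triangle[of x z w] assms by linarith
  qed
  then show ?thesis by linarith
qed

lemma e_of_eq_0: "(x, y) \<in> E \<Longrightarrow> e_of d E x y = 0"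
  using e_of_le_d[of x y x] e_of_nonneg[of x y] E_sub by auto

lemma e_of_diff_le_1: "z \<in> M \<Longrightarrow> \<bar>e_of d E z a - e_of d E z b\<bar> \<le> 1"
  using e_of_nonneg[of z a] e_of_nonneg[of z b] e_of_le_1[of z a] e_of_le_1[of z b] by linarith

lemma d_of_e_of_upper:
  assumes "a \<in> M" "b \<in> M" "z \<in> M"
  shows "\<bar>e_of d E z a - e_of d E z b\<bar> \<le> d_of M (e_of d E) a b"
proof -
  have "bdd_above ((\<lambda>z. \<bar>e_of d E z a - e_of d E z b\<bar>) ` M)"
    using e_of_diff_le_1 by (intro bdd_aboveI[of _ 1]) auto
  then show ?thesis using assms by (auto simp: d_of_def intro: cSUP_upper)
qed

lemma d_of_e_of_least:
  assumes "a \<in> M" "b \<in> M" "\<And>z. z \<in> M \<Longrightarrow> \<bar>e_of d E z a - e_of d E z b\<bar> \<le> t"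
  shows "d_of M (e_of d E) a b \<le> t"
  using assms nonempty by (auto simp: d_of_def intro!: cSUP_least)

text \<open>If the members of \<open>b\<close> are within \<open>t\<close> of \<open>a\<close>, then so are all points up to their distance to \<open>b\<close>:
go to a nearby member of \<open>b\<close> first. The strict form of the premise matches the quantifier over
all \<open>r > t\<close> in the definition of the Hausdorff distance.\<close>
lemma e_of_le_e_of_plus:
  assumes "z \<in> M" "t \<ge> 0"
    and "\<And>w r. (w, b) \<in> E \<Longrightarrow> r > t \<Longrightarrow> e_of d E w a < r"
  shows "e_of d E z a \<le> e_of d E z b + t"
proof -
  have "e_of d E z a - t \<le> e_of d E z b"
  proof (rule le_e_of)
    show "e_of d E z a - t \<le> 1" using e_of_le_1[OF \<open>z \<in> M\<close>, of a] \<open>t \<ge> 0\<close> by linarith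
    fix w assume w: "(w, b) \<in> E"
    then have "w \<in> M" using E_sub by auto
    have "e_of d E w a \<le> t" using assms(3)[OF w] by (meson dense_ge less_imp_le)
    then show "e_of d E z a - t \<le> d z w"
      using e_of_triangle[OF \<open>z \<in> M\<close> \<open>w \<in> M\<close>, of a] by linarith
  qed
  then show ?thesis by linarith
qed

text \<open>The Hausdorff distance of two sets is the uniform distance of their distance functions. One
direction evaluates the distance functions at members of the sets, where one of them vanishes;
the other is the triangle inequality above. The value \<open>1\<close> for the distance to the empty set
fits the convention for the Hausdorff distance from the empty set.\<close>
lemma hausdorff_dist_extension:
  assumes "a \<in> M" "b \<in> M"
  shows "hausdorff_dist d (extension E a) (extension E b) = d_of M (e_of d E) a b"
proof -
  let ?D = "d_of M (e_of d E) a b"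
  consider "extension E a = {}" "extension E b = {}"
    | "extension E a = {} \<longleftrightarrow> extension E b \<noteq> {}"
    | "extension E a \<noteq> {}" "extension E b \<noteq> {}" by blast
  then show ?thesis
  proof cases
    case 1
    have "?D = 0"
      using assms nonempty 1 by (simp add: d_of_def e_of_empty)
    then show ?thesis using 1 by (simp add: hausdorff_dist_def)
  next
    case 2
    have "?D \<le> 1"
      using assms by (intro d_of_e_of_least e_of_diff_le_1)
    moreover have "?D \<ge> 1"
    proof -
      obtain c z where c: "(z, c) \<in> E" "c = a \<or> c = b" using 2 by (auto simp: extension_def)
      have "e_of d E z c = 0" "z \<in> M" using c E_sub by (auto intro: e_of_eq_0)
      moreover have "extension E a = {} \<or> extension E b = {}" using 2 by blast
      ultimately show ?thesis
        using d_of_e_of_upper[OF assms, of z] c e_of_empty[of a z] e_of_empty[of b z] by auto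
    qed
    ultimately show ?thesis using 2 by (auto simp: hausdorff_dist_def)
  next
    case 3
    have "(LEAST t. 0 \<le> t \<and> t \<le> 1 \<and> (\<forall>r>t. (\<forall>x\<in>extension E a. \<exists>y\<in>extension E b. d x y < r) \<and>
       (\<forall>x\<in>extension E b. \<exists>y\<in>extension E a. d x y < r))) = ?D"
    proof (rule Least_equality, intro conjI allI impI ballI)
      obtain m where "m \<in> M" using nonempty by blast
      show "0 \<le> ?D" using d_of_e_of_upper[OF assms \<open>m \<in> M\<close>] by linarith
      show "?D \<le> 1"
        using assms by (intro d_of_e_of_least e_of_diff_le_1)
    next
      fix r x assume r: "?D < r" and "x \<in> extension E a"
      then have "e_of d E x a = 0" "x \<in> M" using E_sub by (auto simp: extension_def intro: e_of_eq_0)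
      then have "e_of d E x b < r" using d_of_e_of_upper[OF assms, of x] r by auto
      then show "\<exists>y\<in>extension E b. d x y < r"
        using 3 by (elim e_of_less_witness) (auto simp: extension_def)
    next
      fix r x assume r: "?D < r" and "x \<in> extension E b"
      then have "e_of d E x b = 0" "x \<in> M" using E_sub by (auto simp: extension_def intro: e_of_eq_0)
      then have "e_of d E x a < r" using d_of_e_of_upper[OF assms, of x] r by auto
      then show "\<exists>y\<in>extension E a. d x y < r"
        using 3 by (elim e_of_less_witness) (auto simp: extension_def)
    next
      fix t :: real
      assume t: "0 \<le> t \<and> t \<le> 1 \<and> (\<forall>r>t. (\<forall>x\<in>extension E a. \<exists>y\<in>extension E b. d x y < r) \<and>
       (\<forall>x\<in>extension E b. \<exists>y\<in>extension E a. d x y < r))"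
      show "?D \<le> t"
      proof (rule d_of_e_of_least[OF assms])
        fix z assume z: "z \<in> M"
        have near: "e_of d E w p < r"
          if w: "(w, q) \<in> E" "r > t" "p = a \<and> q = b \<or> p = b \<and> q = a" for w r p q
        proof -
          have "\<exists>y. (y, p) \<in> E \<and> d w y < r" using t w by (auto simp: extension_def)
          then obtain y where "(y, p) \<in> E" "d w y < r" by blast
          then show ?thesis using e_of_le_d[of y p w] by linarith
        qed
        have "e_of d E z a \<le> e_of d E z b + t"
          using t z by (auto intro: e_of_le_e_of_plus near)
        moreover have "e_of d E z b \<le> e_of d E z a + t"
          using t z by (auto intro: e_of_le_e_of_plus near)
        ultimately show "\<bar>e_of d E z a - e_of d E z b\<bar> \<le> t" by linarith
      qed
    qed
    then show ?thesis using 3 by (simp add: hausdorff_dist_def)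
  qed
qed

end

section \<open>Structures in which membership and metric determine each other\<close>

text \<open>The common ground of the two presentations: \<open>e\<close> is the distance to the extension, \<open>E\<close> is the zero
set of \<open>e\<close>, and \<open>d\<close> is the uniform distance of the functions \<open>e(\<cdot>, x)\<close>. Equalities with \<open>e\<close> and
\<open>d\<close> are only demanded on \<open>M\<close>, because outside \<open>M\<close> the functions are arbitrary.\<close>
locale membership_structure = bounded_relation M d E
  for M :: "'a set" and d E +
  fixes e :: "'a \<Rightarrow> 'a \<Rightarrow> real"
  assumes complete: "mcomplete"
    and e_eq: "\<And>x y. x \<in> M \<Longrightarrow> y \<in> M \<Longrightarrow> e x y = e_of d E x y"
    and e_eq_0_iff: "\<And>x y. x \<in> M \<Longrightarrow> y \<in> M \<Longrightarrow> e x y = 0 \<longleftrightarrow> (x, y) \<in> E"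
    and d_eq: "\<And>x y. x \<in> M \<Longrightarrow> y \<in> M \<Longrightarrow> d x y = d_of M e x y"
begin

lemma e_nonneg: "x \<in> M \<Longrightarrow> y \<in> M \<Longrightarrow> 0 \<le> e x y"
  by (simp add: e_eq e_of_nonneg)

lemma e_le_1: "x \<in> M \<Longrightarrow> y \<in> M \<Longrightarrow> e x y \<le> 1"
  by (simp add: e_eq e_of_le_1)

lemma d_of_e_of: "x \<in> M \<Longrightarrow> y \<in> M \<Longrightarrow> d_of M (e_of d E) x y = d x y"
  by (auto simp: d_eq d_of_def e_eq)

lemma e_diff_le_d: "x \<in> M \<Longrightarrow> y \<in> M \<Longrightarrow> z \<in> M \<Longrightarrow> \<bar>e z x - e z y\<bar> \<le> d x y"
  using d_of_e_of_upper[of x y z] by (simp add: d_of_e_of e_eq)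

lemma e_triangle: "x \<in> M \<Longrightarrow> y \<in> M \<Longrightarrow> z \<in> M \<Longrightarrow> e x y \<le> d x z + e z y"
  using e_of_triangle[of x z y] by (simp add: e_eq)

lemma e_less_witness:
  assumes "x \<in> M" "y \<in> M" "e x y < t" "t \<le> 1 \<or> extension E y \<noteq> {}"
  obtains z where "(z, y) \<in> E" "d x z < t"
  using assms e_of_less_witness[of x y t] by (auto simp: e_eq)

text \<open>A member of \<open>a\<close> has \<open>e\<close>-value at most \<open>d a b\<close> at \<open>b\<close>, hence is near a member of \<open>b\<close>.\<close>
lemma extension_witness:
  assumes "(z, a) \<in> E" "b \<in> M" "d a b < t" "t \<le> 1 \<or> extension E b \<noteq> {}"
  obtains w where "(w, b) \<in> E" "d z w < t"
proof -
  have zM: "z \<in> M" "a \<in> M" using assms(1) E_sub by auto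
  then have "e z b < t"
    using assms e_diff_le_d[of a b z] e_eq_0_iff[of z a] by simp
  then show thesis using e_less_witness zM assms that by metis
qed

lemma d_le_if_extension_close:
  assumes ab: "a \<in> M" "b \<in> M"
    and "\<And>w. (w, b) \<in> E \<Longrightarrow> e w a \<le> t" "\<And>w. (w, a) \<in> E \<Longrightarrow> e w b \<le> t" and "t \<ge> 0"
  shows "d a b \<le> t"
proof -
  have near: "e_of d E w p < r"
    if "(w, q) \<in> E" "r > t" "p = a \<and> q = b \<or> p = b \<and> q = a" for w r p q
  proof -
    have "e w p \<le> t" using assms that by blast
    moreover have "e w p = e_of d E w p" using that ab E_sub by (auto intro: e_eq)
    ultimately show ?thesis using that by linarith
  qed
  have "\<bar>e_of d E z a - e_of d E z b\<bar> \<le> t" if z: "z \<in> M" for z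
  proof -
    have "e_of d E z a \<le> e_of d E z b + t" "e_of d E z b \<le> e_of d E z a + t"
      using z \<open>t \<ge> 0\<close> by (auto intro!: e_of_le_e_of_plus near)
    then show ?thesis by linarith
  qed
  then have "d_of M (e_of d E) a b \<le> t" by (intro d_of_e_of_least ab)
  then show ?thesis using ab by (simp add: d_of_e_of)
qed

lemma Le_structure: "Le_structure M e"
  using nonempty e_nonneg e_le_1 by (auto simp: Le_structure_def)

text \<open>Closedness of \<open>E\<close> holds because \<open>e\<close> is \<open>1\<close>-Lipschitz in each argument, so that \<open>e\<close> cannot vanish
on the product of two balls of radius \<open>e x y / 2\<close>.\<close>
lemma metric_set_structure: "metric_set_structure M d E"
  unfolding metric_set_structure_def
proof (intro conjI ballI)
  have "openin (prod_topology mtopology mtopology) (M \<times> M - E)"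
    unfolding openin_prod_topology_alt
  proof (intro allI impI)
    fix x y assume xy: "(x, y) \<in> M \<times> M - E"
    define r where "r = e x y / 2"
    have "r > 0"
      using xy e_nonneg[of x y] e_eq_0_iff[of x y] by (auto simp: r_def less_le)
    have "mball x r \<times> mball y r \<subseteq> M \<times> M - E"
    proof clarsimp
      fix x' y' assume *: "x \<in> M" "x' \<in> M" "d x x' < r" "y \<in> M" "y' \<in> M" "d y y' < r" "(x', y') \<in> E"
      then have "e x y' < r" using e_triangle[of x y' x'] e_eq_0_iff[of x' y'] by auto
      then show False using * e_diff_le_d[of y y' x] by (auto simp: r_def)
    qed
    then show "\<exists>U V. openin mtopology U \<and> openin mtopology V \<and> x \<in> U \<and> y \<in> V \<and> U \<times> V \<subseteq> M \<times> M - E"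
      using xy \<open>r > 0\<close> by (intro exI[of _ "mball x r"] exI[of _ "mball y r"]) auto
  qed
  then show "closedin (prod_topology mtopology mtopology) E"
    using E_sub by (simp add: closedin_def)
  show "d a b = hausdorff_dist d (extension E a) (extension E b)" if "a \<in> M" "b \<in> M" for a b
    using that by (simp add: hausdorff_dist_extension d_of_e_of)
qed (use nonempty complete d_le_1 Metric_space_axioms in auto)

text \<open>The infimum is at least \<open>e x y\<close> by the triangle inequality, and members \<open>z\<close> of \<open>y\<close> contribute
exactly \<open>d x z\<close> to it, since \<open>e z y = 0\<close>.\<close>
lemma H_extensional: "H_extensional M e"
  unfolding H_extensional_def
proof (intro ballI antisym)
  fix x y assume xy: "x \<in> M" "y \<in> M"
  let ?f = "\<lambda>z. min (d_of M e x z + 2 * e z y) 1"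
  show "e x y \<le> (INF z\<in>M. ?f z)"
  proof (rule cINF_greatest[OF nonempty])
    fix z assume "z \<in> M"
    then show "e x y \<le> ?f z"
      using xy e_triangle[of x y z] e_nonneg[of z y] e_le_1[of x y] by (simp flip: d_eq)
  qed
  have bdd: "bdd_below (?f ` M)"
    using e_nonneg xy by (intro bdd_belowI[of _ 0]) (auto simp flip: d_eq)
  have "(INF z\<in>M. ?f z) \<le> e_of d E x y"
  proof (rule le_e_of)
    show "(INF z\<in>M. ?f z) \<le> 1" by (rule cINF_lower2[OF bdd \<open>x \<in> M\<close>]) simp
    fix z assume z: "(z, y) \<in> E"
    then have "z \<in> M" using E_sub by auto
    show "(INF z\<in>M. ?f z) \<le> d x z"
      using z xy \<open>z \<in> M\<close> e_eq_0_iff[of z y] by (intro cINF_lower2[OF bdd \<open>z \<in> M\<close>]) (auto simp flip: d_eq)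
  qed
  then show "(INF z\<in>M. ?f z) \<le> e x y" using xy by (simp add: e_eq)
qed

end

lemma metric_set_structure_imp_membership_structure:
  assumes "metric_set_structure M d E"
  shows "membership_structure M d E (e_of d E)"
proof -
  interpret Metric_space M d using assms by (simp add: metric_set_structure_def)
  have closed: "closedin (prod_topology mtopology mtopology) E"
    using assms by (simp add: metric_set_structure_def)
  interpret bounded_relation M d E
    using assms closedin_subset[OF closed] by unfold_locales (auto simp: metric_set_structure_def)
  show ?thesis
  proof
    show "mcomplete" using assms by (simp add: metric_set_structure_def)
    show "d x y = d_of M (e_of d E) x y" if "x \<in> M" "y \<in> M" for x y
      using assms that hausdorff_dist_extension[OF that] by (simp add: metric_set_structure_def)
    show "e_of d E x y = 0 \<longleftrightarrow> (x, y) \<in> E" if xy: "x \<in> M" "y \<in> M" for x y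
    proof
      show "e_of d E x y = 0" if "(x, y) \<in> E" using that by (rule e_of_eq_0)
      assume 0: "e_of d E x y = 0"
      show "(x, y) \<in> E"
      proof (rule ccontr)
        assume "(x, y) \<notin> E"
        then have "(x, y) \<in> M \<times> M - E" using xy by simp
        moreover have "openin (prod_topology mtopology mtopology) (M \<times> M - E)"
          using closed by (simp add: closedin_def)
        ultimately have "\<exists>U V. openin mtopology U \<and> openin mtopology V \<and> x \<in> U \<and> y \<in> V \<and> U \<times> V \<subseteq> M \<times> M - E"
          unfolding openin_prod_topology_alt by (elim allE impE)
        then obtain U V where UV: "openin mtopology U" "x \<in> U" "y \<in> V" "U \<times> V \<subseteq> M \<times> M - E"
          by (elim exE conjE)
        then obtain r where r: "r > 0" "mball x r \<subseteq> U" by (auto simp: openin_mtopology)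
        obtain z where z: "(z, y) \<in> E" "d x z < min r 1"
          using e_of_less_witness[of x y "min r 1"] 0 r by auto
        then have "z \<in> mball x r" using xy E_sub by auto
        then have "(z, y) \<in> U \<times> V" using r UV by auto
        then show False using z UV by auto
      qed
    qed
  qed simp
qed

text \<open>The substance here is that \<open>e x y\<close> really is the distance from \<open>x\<close> to the zero set of \<open>e(\<cdot>, y)\<close>.
If \<open>e x y < t \<le> 1\<close>, then \<open>H\<close>-extensionality yields a point \<open>u\<close> with \<open>d x u + 2 * e u y < t\<close>: moving
by less than \<open>t\<close> brings the value of \<open>e\<close> below \<open>t / 2\<close>. Iterating this and using completeness
gives a zero at distance at most \<open>2 * t\<close>. The factor \<open>2\<close> is then absorbed by the factor \<open>2\<close>
in \<open>H\<close>-extensionality: one step to \<open>u\<close>, followed by a zero at distance at most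
\<open>2 * ((t - d x u) / 2)\<close> from \<open>u\<close>, costs at most \<open>t\<close> in total.\<close>
lemma H_extensional_imp_membership_structure:
  assumes "Le_structure M e" "H_extensional M e" "Metric_space M (d_of M e)"
    and complete: "Metric_space.mcomplete M (d_of M e)"
  shows "membership_structure M (d_of M e) (E_of M e) e"
proof -
  let ?d = "d_of M e" and ?E = "E_of M e"
  interpret Metric_space M ?d by fact
  have e01: "0 \<le> e x y" "e x y \<le> 1" if "x \<in> M" "y \<in> M" for x y
    using assms(1) that by (auto simp: Le_structure_def)
  have e_diff: "\<bar>e z x - e z y\<bar> \<le> 1" if "x \<in> M" "y \<in> M" "z \<in> M" for x y z
    using e01[of z x] e01[of z y] that by linarith
  have d_ge: "\<bar>e z x - e z y\<bar> \<le> ?d x y" if "x \<in> M" "y \<in> M" "z \<in> M" for x y z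
  proof -
    have "bdd_above ((\<lambda>z. \<bar>e z x - e z y\<bar>) ` M)"
      using e_diff that by (intro bdd_aboveI[of _ 1]) auto
    then show ?thesis using that by (auto simp: d_of_def intro: cSUP_upper)
  qed
  have nonempty: "M \<noteq> {}" using assms(1) by (simp add: Le_structure_def)
  have d_le_1: "?d x y \<le> 1" if "x \<in> M" "y \<in> M" for x y
    using nonempty e_diff that by (auto simp: d_of_def intro!: cSUP_least)
  interpret bounded_relation M ?d ?E
  proof
    show "M \<noteq> {}" by (fact nonempty)
    show "?d x y \<le> 1" if "x \<in> M" "y \<in> M" for x y using that by (fact d_le_1)
    show "?E \<subseteq> M \<times> M" by (auto simp: E_of_def)
  qed
  let ?f = "\<lambda>x y z. min (?d x z + 2 * e z y) 1"
  have H: "e x y = (INF z\<in>M. ?f x y z)" if "x \<in> M" "y \<in> M" for x y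
    using assms(2) that unfolding H_extensional_def by blast
  have bdd: "bdd_below (?f x y ` M)" if "x \<in> M" "y \<in> M" for x y
    using e01 that by (intro bdd_belowI[of _ 0]) auto
  have step: "\<exists>u\<in>M. ?d x u + 2 * e u y < t" if "x \<in> M" "y \<in> M" "e x y < t" "t \<le> 1" for x y t
  proof -
    have "(INF z\<in>M. ?f x y z) < t" using that H[of x y] by linarith
    then obtain u where "u \<in> M" "?f x y u < t"
      using cINF_less_iff[OF nonempty bdd, of x y t] \<open>x \<in> M\<close> \<open>y \<in> M\<close> by auto
    then show ?thesis using \<open>t \<le> 1\<close> by (intro bexI[of _ u]) auto
  qed
  have e_triangle: "e x y \<le> ?d x z + e z y" if "x \<in> M" "y \<in> M" "z \<in> M" for x y z
  proof -
    have "e x y - ?d x z \<le> (INF w\<in>M. ?f z y w)"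
    proof (rule cINF_greatest[OF nonempty])
      fix w assume w: "w \<in> M"
      have "e x y \<le> ?f x y w"

          unfolding H[OF that(1,2)] using w by (rule cINF_lower[OF bdd[OF that(1,2)]])
      then show "e x y - ?d x z \<le> ?f z y w"
        using triangle[OF that(1,3) w] nonneg[of x z] by linarith
    qed
    then show ?thesis using H[OF that(3,2)] by linarith
  qed
  \<comment> \<open>Zeros up to the factor \<open>2\<close>, by iteration.\<close>
  have close_root: "\<exists>z. (z, y) \<in> ?E \<and> ?d x z \<le> 2 * t" if xy: "x \<in> M" "y \<in> M" "e x y < t" "t \<le> 1" for x y t
  proof -
    have "t > 0" using e01[of x y] xy by linarith
    obtain l where l: "l \<in> M" "?d x l \<le> 2 * 1 * t"
      and lim: "\<And>\<eta>. \<eta> > 0 \<Longrightarrow> \<exists>x\<in>M. \<exists>s>0. s < \<eta> \<and> ?d x l < \<eta> \<and> e x y < s \<and> s \<le> 1"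
    proof (rule mcomplete_iteration[where P = "\<lambda>x s. e x y < s \<and> s \<le> 1" and p = x and t = t and c = 1])
      show "\<exists>u\<in>M. (e u y < s / 2 \<and> s / 2 \<le> 1) \<and> ?d x u \<le> 1 * s"
        if xs: "x \<in> M" "s > 0" "e x y < s \<and> s \<le> 1" for x s
      proof -
        obtain u where "u \<in> M" "?d x u + 2 * e u y < s" using step[of x y s] xy xs by blast
        then show ?thesis using xs nonneg[of x u] e01(1)[of u y] xy by (intro bexI[of _ u] conjI; linarith)
      qed
    qed (use complete xy \<open>t > 0\<close> in auto)
    have "e l y \<le> 0"
    proof (rule field_le_epsilon)
      fix \<eta> :: real assume "\<eta> > 0"
      then obtain z s where "z \<in> M" "s < \<eta> / 2" "?d z l < \<eta> / 2" "e z y < s"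
        using lim[of "\<eta> / 2"] by auto
      then show "e l y \<le> 0 + \<eta>" using e_triangle[of l y z] l xy commute[of l z] by auto
    qed
    then have "(l, y) \<in> ?E" using l xy e01[of l y] by (auto simp: E_of_def)
    then show ?thesis using l by auto
  qed
  \<comment> \<open>The factor is removed by one initial step.\<close>
  have root: "\<exists>z. (z, y) \<in> ?E \<and> ?d x z \<le> t" if xy: "x \<in> M" "y \<in> M" "e x y < t" "t \<le> 1" for x y t
  proof -
    obtain u where u: "u \<in> M" "?d x u + 2 * e u y < t" using step xy by blast
    have "t - ?d x u \<le> 1" using nonneg[of x u] \<open>t \<le> 1\<close> by linarith
    then have "e u y < (t - ?d x u) / 2" "(t - ?d x u) / 2 \<le> 1" using u by auto
    then obtain z where z: "(z, y) \<in> ?E" "?d u z \<le> t - ?d x u"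
      using close_root[of u y] u xy by fastforce
    then have "?d x z \<le> t" using triangle[of x u z] u xy E_sub by auto
    then show ?thesis using z by auto
  qed
  have e_eq: "e x y = e_of ?d ?E x y" if xy: "x \<in> M" "y \<in> M" for x y
  proof (rule antisym)
    show "e x y \<le> e_of ?d ?E x y"
    proof (rule le_e_of)
      fix z assume z: "(z, y) \<in> ?E"
      then have "z \<in> M" "e z y = 0" by (auto simp: E_of_def)
      then show "e x y \<le> ?d x z" using e_triangle[of x y z] xy by auto
    qed (use e01 xy in auto)
    show "e_of ?d ?E x y \<le> e x y"
    proof (rule ccontr)
      assume *: "\<not> ?thesis"
      define t where "t = (e x y + e_of ?d ?E x y) / 2"
      have "t \<le> 1" "e x y < t" "t < e_of ?d ?E x y"
        using * e_of_le_1[OF \<open>x \<in> M\<close>, of y] by (auto simp: t_def)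
      then obtain z where "(z, y) \<in> ?E" "?d x z \<le> t" using root[of x y t] xy by auto
      then show False using e_of_le_d[of z y x] \<open>t < e_of ?d ?E x y\<close> by linarith
    qed
  qed
  show ?thesis
    by unfold_locales (use complete e_eq in \<open>auto simp: E_of_def\<close>)
qed

section \<open>Bounds and Lipschitz continuity of formula values\<close>

lemma mse_v_nonneg: "0 \<le> mse_v \<phi>"
  by (induction \<phi>) auto

text \<open>Infima reduce to suprema of the negated formula. For bounded quantifiers this includes the
empty case, since the default values are chosen as \<open>- v\<close> and \<open>v\<close>.\<close>
lemma mse_val_MInf: "mse_val M d E (MInf x \<phi>) \<rho> = - mse_val M d E (MSup x (MScale (-1) \<phi>)) \<rho>"
  by (simp add: INF_eq_minus_SUP)

lemma mse_val_MInfIn: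
  "mse_val M d E (MInfIn x y \<phi>) \<rho> = - mse_val M d E (MSupIn x y (MScale (-1) \<phi>)) \<rho>"
  by (simp add: INF_eq_minus_SUP)

context membership_structure
begin

abbreviation valuation :: "(nat \<Rightarrow> 'a) \<Rightarrow> bool" where
  "valuation \<rho> \<equiv> range \<rho> \<subseteq> M"

lemma valuation_upd: "valuation \<rho> \<Longrightarrow> a \<in> M \<Longrightarrow> valuation (\<rho>(x := a))"
  by auto

lemma valuation_upd_extension: "valuation \<rho> \<Longrightarrow> a \<in> extension E y \<Longrightarrow> valuation (\<rho>(x := a))"
  using extension_sub by auto

text \<open>That \<open>v\<close> bounds the formula is what makes its default values for empty bounded quantifiers the
extreme possible ones.\<close>
lemma abs_mse_val_le: "valuation \<rho> \<Longrightarrow> \<bar>mse_val M d E \<phi> \<rho>\<bar> \<le> mse_v \<phi>"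
proof (induction \<phi> arbitrary: \<rho>)
  case (MDist x y)
  then show ?case using d_le_1[of "\<rho> x" "\<rho> y"] by auto
next
  case (MAdd \<phi> \<psi>)
  from MAdd.IH[OF MAdd.prems] show ?case by (simp add: abs_le_iff)
next
  case (MMax \<phi> \<psi>)
  from MMax.IH[OF MMax.prems] show ?case unfolding mse_val.simps mse_v.simps by linarith
next
  case (MMin \<phi> \<psi>)
  from MMin.IH[OF MMin.prems] show ?case unfolding mse_val.simps mse_v.simps by linarith
next
  case (MScale r \<phi>)
  then show ?case by (auto simp: abs_mult intro: mult_left_mono)
next
  case (MSup x \<phi>)
  show ?case unfolding mse_val.simps mse_v.simps
    by (intro abs_SUP_le nonempty MSup.IH valuation_upd MSup.prems)
next
  case (MInf x \<phi>)
  show ?case unfolding mse_val.simps mse_v.simps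
    by (intro abs_INF_le nonempty MInf.IH valuation_upd MInf.prems)
next
  case (MSupIn x y \<phi>)
  show ?case
  proof (cases "extension E (\<rho> y) = {}")
    case False
    then show ?thesis unfolding mse_val.simps mse_v.simps if_not_P[OF False]
      by (intro abs_SUP_le MSupIn.IH valuation_upd_extension MSupIn.prems)
  qed (simp add: mse_v_nonneg)
next
  case (MInfIn x y \<phi>)
  show ?case
  proof (cases "extension E (\<rho> y) = {}")
    case False
    then show ?thesis unfolding mse_val.simps mse_v.simps if_not_P[OF False]
      by (intro abs_INF_le MInfIn.IH valuation_upd_extension MInfIn.prems)
  qed (simp add: mse_v_nonneg)
qed simp

text \<open>The empty set has Hausdorff distance \<open>1\<close> from every nonempty set.\<close>
lemma nonempty_extension:
  assumes "extension E a \<noteq> {}" "b \<in> M" "d a b < 1"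
  shows "extension E b \<noteq> {}"
proof -
  obtain z where "(z, a) \<in> E" using assms(1) by (auto simp: extension_def)
  then obtain w where "(w, b) \<in> E" by (rule extension_witness[OF _ assms(2,3)]) auto
  then show ?thesis by (auto simp: extension_def)
qed

text \<open>Lipschitz continuity for valuations with the uniform distance. Letting all variables move at
once is what the induction over formulas needs: in a bounded quantifier the bound and the
quantified variable change together.\<close>
definition lipschitz_value :: "real \<Rightarrow> ((nat \<Rightarrow> 'a) \<Rightarrow> real) \<Rightarrow> bool" where
  "lipschitz_value K f \<longleftrightarrow>
     (\<forall>\<rho> \<rho>' t. valuation \<rho> \<longrightarrow> valuation \<rho>' \<longrightarrow> (\<forall>i. d (\<rho> i) (\<rho>' i) \<le> t) \<longrightarrow> \<bar>f \<rho> - f \<rho>'\<bar> \<le> K * t)"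

lemma lipschitz_valueI:
  assumes "\<And>\<rho> \<rho>' t. valuation \<rho> \<Longrightarrow> valuation \<rho>' \<Longrightarrow> (\<And>i. d (\<rho> i) (\<rho>' i) \<le> t) \<Longrightarrow> \<bar>f \<rho> - f \<rho>'\<bar> \<le> K * t"
  shows "lipschitz_value K f"
  using assms unfolding lipschitz_value_def by blast

lemma lipschitz_valueD:
  assumes "lipschitz_value K f" "valuation \<rho>" "valuation \<rho>'" "\<And>i. d (\<rho> i) (\<rho>' i) \<le> t"
  shows "\<bar>f \<rho> - f \<rho>'\<bar> \<le> K * t"
  using assms unfolding lipschitz_value_def by blast

lemma lipschitz_value_uminus: "lipschitz_value K (\<lambda>\<rho>. - f \<rho>) \<longleftrightarrow> lipschitz_value K f"
  by (simp add: lipschitz_value_def abs_minus_commute)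

text \<open>If both extensions are nonempty, each member of one is matched with a member of the other at a
distance barely above \<open>t\<close>. If exactly one is empty, then \<open>t \<ge> 1\<close>, and the bound
\<open>2 * v\<close> on the difference of any two values suffices. This is why the constant is \<open>2 * v\<close>.\<close>
lemma lipschitz_value_MSupIn:
  assumes \<phi>: "lipschitz_value (2 * mse_v \<phi>) (mse_val M d E \<phi>)"
  shows "lipschitz_value (2 * mse_v \<phi>) (mse_val M d E (MSupIn x y \<phi>))"
proof (rule lipschitz_valueI)
  fix \<rho> \<rho>' t assume \<rho>: "valuation \<rho>" "valuation \<rho>'" "\<And>i. d (\<rho> i) (\<rho>' i) \<le> t"
  let ?goal = "\<bar>mse_val M d E (MSupIn x y \<phi>) \<rho> - mse_val M d E (MSupIn x y \<phi>) \<rho>'\<bar> \<le> 2 * mse_v \<phi> * t"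
  let ?A = "extension E (\<rho> y)" and ?B = "extension E (\<rho>' y)"
  have y: "\<rho> y \<in> M" "\<rho>' y \<in> M" using \<rho> by auto
  have t: "t \<ge> 0" by (rule order_trans[OF nonneg \<rho>(3)[of 0]])
  consider "?A = {}" "?B = {}" | "?A = {} \<longleftrightarrow> ?B \<noteq> {}" | "?A \<noteq> {}" "?B \<noteq> {}" by blast
  then show ?goal
  proof cases
    case 1
    then show ?goal using t mse_v_nonneg[of \<phi>] by simp
  next
    case 2
    have "1 \<le> d (\<rho> y) (\<rho>' y)"
    proof (rule ccontr)
      assume "\<not> ?thesis"
      then have *: "d (\<rho> y) (\<rho>' y) < 1" "d (\<rho>' y) (\<rho> y) < 1" by (auto simp: commute)
      show False using 2 nonempty_extension[OF _ y(2) *(1)] nonempty_extension[OF _ y(1) *(2)] by blast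
    qed
    then have "1 \<le> t" using \<rho>(3)[of y] by linarith
    then have "2 * mse_v \<phi> * 1 \<le> 2 * mse_v \<phi> * t" using mse_v_nonneg[of \<phi>] by (intro mult_left_mono) auto
    then show ?goal
      using abs_mse_val_le[OF \<rho>(1), of "MSupIn x y \<phi>"] abs_mse_val_le[OF \<rho>(2), of "MSupIn x y \<phi>"]
      by (simp only: mse_v.simps)
  next
    case 3
    show ?goal
    proof (rule le_scaled_if_le_above)
      fix u assume u: "u > t"
      have near: "\<bar>mse_val M d E \<phi> (\<rho>(x := a)) - mse_val M d E \<phi> (\<rho>'(x := b))\<bar> \<le> 2 * mse_v \<phi> * u"
        if "a \<in> ?A" "b \<in> ?B" "d a b < u" for a b
      proof (rule lipschitz_valueD[OF \<phi>])
        show "d ((\<rho>(x := a)) i) ((\<rho>'(x := b)) i) \<le> u" for i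
          using \<rho>(3)[of i] u that(3) by (cases "i = x") auto
      qed (intro valuation_upd_extension \<rho>(1,2); fact that)+
      have duy: "d (\<rho> y) (\<rho>' y) < u" "d (\<rho>' y) (\<rho> y) < u"
        using u \<rho>(3)[of y] by (auto simp: commute)
      show "\<bar>mse_val M d E (MSupIn x y \<phi>) \<rho> - mse_val M d E (MSupIn x y \<phi>) \<rho>'\<bar> \<le> 2 * mse_v \<phi> * u"
        unfolding mse_val.simps if_not_P[OF 3(1)] if_not_P[OF 3(2)]
      proof (rule abs_SUP_diff_le[OF 3, where v = "mse_v \<phi>" and w = "mse_v \<phi>"])
        fix a assume a: "a \<in> ?A"
        then obtain b where "(b, \<rho>' y) \<in> E" "d a b < u"
          using extension_witness[of a "\<rho> y" "\<rho>' y" u] duy y 3 by (auto simp: extension_def)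
        then show "\<exists>b\<in>?B. \<bar>mse_val M d E \<phi> (\<rho>(x := a)) - mse_val M d E \<phi> (\<rho>'(x := b))\<bar> \<le> 2 * mse_v \<phi> * u"
          using a near[of a b] by (auto simp: extension_def)
      next
        fix b assume b: "b \<in> ?B"
        then obtain a where "(a, \<rho> y) \<in> E" "d b a < u"
          using extension_witness[of b "\<rho>' y" "\<rho> y" u] duy y 3 by (auto simp: extension_def)
        then show "\<exists>a\<in>?A. \<bar>mse_val M d E \<phi> (\<rho>(x := a)) - mse_val M d E \<phi> (\<rho>'(x := b))\<bar> \<le> 2 * mse_v \<phi> * u"
          using b near[of a b] commute[of a b] by (auto simp: extension_def)
      qed (intro abs_mse_val_le valuation_upd_extension \<rho>(1,2), assumption)+
    qed (simp add: mse_v_nonneg)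
  qed
qed

lemma lipschitz_value_MSup:
  assumes \<phi>: "lipschitz_value (2 * mse_v \<phi>) (mse_val M d E \<phi>)"
  shows "lipschitz_value (2 * mse_v \<phi>) (mse_val M d E (MSup x \<phi>))"
proof (rule lipschitz_valueI)
  fix \<rho> \<rho>' t assume \<rho>: "valuation \<rho>" "valuation \<rho>'" "\<And>i. d (\<rho> i) (\<rho>' i) \<le> t"
  let ?goal = "\<bar>mse_val M d E (MSup x \<phi>) \<rho> - mse_val M d E (MSup x \<phi>) \<rho>'\<bar> \<le> 2 * mse_v \<phi> * t"
  have t: "t \<ge> 0" by (rule order_trans[OF nonneg \<rho>(3)[of 0]])
  have "\<bar>mse_val M d E \<phi> (\<rho>(x := a)) - mse_val M d E \<phi> (\<rho>'(x := a))\<bar> \<le> 2 * mse_v \<phi> * t"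
    if "a \<in> M" for a
  proof (rule lipschitz_valueD[OF \<phi>])
    show "d ((\<rho>(x := a)) i) ((\<rho>'(x := a)) i) \<le> t" for i
      using \<rho>(3)[of i] t that by (cases "i = x") auto
  qed (intro valuation_upd \<rho>(1,2) that)+
  note close = this
  show ?goal
    unfolding mse_val.simps
  proof (rule abs_SUP_diff_le[OF nonempty nonempty, where v = "mse_v \<phi>" and w = "mse_v \<phi>"])
    fix a assume a: "a \<in> M"
    show "\<bar>mse_val M d E \<phi> (\<rho>(x := a))\<bar> \<le> mse_v \<phi>" "\<bar>mse_val M d E \<phi> (\<rho>'(x := a))\<bar> \<le> mse_v \<phi>"
      by (intro abs_mse_val_le valuation_upd \<rho>(1,2) a)+
    show "\<exists>b\<in>M. \<bar>mse_val M d E \<phi> (\<rho>(x := a)) - mse_val M d E \<phi> (\<rho>'(x := b))\<bar> \<le> 2 * mse_v \<phi> * t"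
      "\<exists>b\<in>M. \<bar>mse_val M d E \<phi> (\<rho>(x := b)) - mse_val M d E \<phi> (\<rho>'(x := a))\<bar> \<le> 2 * mse_v \<phi> * t"
      using close[OF a] a by blast+
  qed
qed

lemma lipschitz_value_mse_val: "lipschitz_value (2 * mse_v \<phi>) (mse_val M d E \<phi>)"
proof (induction \<phi>)
  case MOne
  show ?case
  proof (rule lipschitz_valueI)
    fix \<rho> \<rho>' :: "nat \<Rightarrow> 'a" and t assume "\<And>i. d (\<rho> i) (\<rho>' i) \<le> t"
    then have "t \<ge> 0" by (rule order_trans[OF nonneg])
    then show "\<bar>mse_val M d E MOne \<rho> - mse_val M d E MOne \<rho>'\<bar> \<le> 2 * mse_v MOne * t" by simp
  qed
next
  case (MDist x y)
  show ?case
  proof (rule lipschitz_valueI)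
    fix \<rho> \<rho>' :: "nat \<Rightarrow> 'a" and t assume \<rho>: "valuation \<rho>" "valuation \<rho>'" "\<And>i. d (\<rho> i) (\<rho>' i) \<le> t"
    then have m: "\<rho> x \<in> M" "\<rho> y \<in> M" "\<rho>' x \<in> M" "\<rho>' y \<in> M" by auto
    have "d (\<rho> x) (\<rho> y) \<le> d (\<rho> x) (\<rho>' x) + d (\<rho>' x) (\<rho>' y) + d (\<rho>' y) (\<rho> y)"
      using triangle[of "\<rho> x" "\<rho>' x" "\<rho> y"] triangle[of "\<rho>' x" "\<rho>' y" "\<rho> y"] m by linarith
    moreover have "d (\<rho>' x) (\<rho>' y) \<le> d (\<rho>' x) (\<rho> x) + d (\<rho> x) (\<rho> y) + d (\<rho> y) (\<rho>' y)"
      using triangle[of "\<rho>' x" "\<rho> x" "\<rho>' y"] triangle[of "\<rho> x" "\<rho> y" "\<rho>' y"] m by linarith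
    ultimately show "\<bar>mse_val M d E (MDist x y) \<rho> - mse_val M d E (MDist x y) \<rho>'\<bar> \<le> 2 * mse_v (MDist x y) * t"
      using \<rho>(3)[of x] \<rho>(3)[of y] commute[of "\<rho> x" "\<rho>' x"] commute[of "\<rho> y" "\<rho>' y"] by simp
  qed
next
  case (MAdd \<phi> \<psi>)
  show ?case
  proof (rule lipschitz_valueI)
    fix \<rho> \<rho>' :: "nat \<Rightarrow> 'a" and t assume \<rho>: "valuation \<rho>" "valuation \<rho>'" "\<And>i. d (\<rho> i) (\<rho>' i) \<le> t"
    from lipschitz_valueD[OF MAdd(1) \<rho>] lipschitz_valueD[OF MAdd(2) \<rho>]
    show "\<bar>mse_val M d E (MAdd \<phi> \<psi>) \<rho> - mse_val M d E (MAdd \<phi> \<psi>) \<rho>'\<bar> \<le> 2 * mse_v (MAdd \<phi> \<psi>) * t"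
      unfolding mse_val.simps mse_v.simps distrib_left distrib_right by linarith
  qed
next
  case (MMax \<phi> \<psi>)
  show ?case
  proof (rule lipschitz_valueI)
    fix \<rho> \<rho>' :: "nat \<Rightarrow> 'a" and t assume \<rho>: "valuation \<rho>" "valuation \<rho>'" "\<And>i. d (\<rho> i) (\<rho>' i) \<le> t"
    note le = lipschitz_valueD[OF MMax(1) \<rho>, THEN le_scaled_max(1)[OF order_trans[OF nonneg \<rho>(3)]]]
      lipschitz_valueD[OF MMax(2) \<rho>, THEN le_scaled_max(2)[OF order_trans[OF nonneg \<rho>(3)]]]
    show "\<bar>mse_val M d E (MMax \<phi> \<psi>) \<rho> - mse_val M d E (MMax \<phi> \<psi>) \<rho>'\<bar> \<le> 2 * mse_v (MMax \<phi> \<psi>) * t"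
      unfolding mse_val.simps mse_v.simps by (intro abs_max_diff_le le)
  qed
next
  case (MMin \<phi> \<psi>)
  show ?case
  proof (rule lipschitz_valueI)
    fix \<rho> \<rho>' :: "nat \<Rightarrow> 'a" and t assume \<rho>: "valuation \<rho>" "valuation \<rho>'" "\<And>i. d (\<rho> i) (\<rho>' i) \<le> t"
    note le = lipschitz_valueD[OF MMin(1) \<rho>, THEN le_scaled_max(1)[OF order_trans[OF nonneg \<rho>(3)]]]
      lipschitz_valueD[OF MMin(2) \<rho>, THEN le_scaled_max(2)[OF order_trans[OF nonneg \<rho>(3)]]]
    show "\<bar>mse_val M d E (MMin \<phi> \<psi>) \<rho> - mse_val M d E (MMin \<phi> \<psi>) \<rho>'\<bar> \<le> 2 * mse_v (MMin \<phi> \<psi>) * t"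
      unfolding mse_val.simps mse_v.simps by (intro abs_max_diff_le le)
  qed
next
  case (MScale r \<phi>)
  show ?case
  proof (rule lipschitz_valueI)
    fix \<rho> \<rho>' :: "nat \<Rightarrow> 'a" and t assume \<rho>: "valuation \<rho>" "valuation \<rho>'" "\<And>i. d (\<rho> i) (\<rho>' i) \<le> t"
    have "\<bar>r\<bar> * \<bar>mse_val M d E \<phi> \<rho> - mse_val M d E \<phi> \<rho>'\<bar> \<le> \<bar>r\<bar> * (2 * mse_v \<phi> * t)"
      by (rule mult_left_mono[OF lipschitz_valueD[OF MScale \<rho>] abs_ge_zero])
    moreover have "\<bar>r\<bar> * (2 * mse_v \<phi> * t) = 2 * (\<bar>r\<bar> * mse_v \<phi>) * t" by (simp only: mult_ac)
    ultimately show "\<bar>mse_val M d E (MScale r \<phi>) \<rho> - mse_val M d E (MScale r \<phi>) \<rho>'\<bar> \<le> 2 * mse_v (MScale r \<phi>) * t"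
      unfolding mse_val.simps mse_v.simps right_diff_distrib[symmetric] abs_mult by linarith
  qed
next
  case (MSup x \<phi>)
  show ?case using lipschitz_value_MSup[OF MSup] unfolding mse_v.simps .
next
  case (MInf x \<phi>)
  have "lipschitz_value (2 * mse_v (MScale (-1) \<phi>)) (mse_val M d E (MScale (-1) \<phi>))"
    using MInf by (simp add: lipschitz_value_def abs_minus_commute)
  from lipschitz_value_MSup[OF this, of x] show ?case
    unfolding mse_val_MInf[abs_def] lipschitz_value_uminus by (simp del: mse_val.simps)
next
  case (MSupIn x y \<phi>)
  show ?case using lipschitz_value_MSupIn[OF MSupIn] unfolding mse_v.simps .
next
  case (MInfIn x y \<phi>)
  have "lipschitz_value (2 * mse_v (MScale (-1) \<phi>)) (mse_val M d E (MScale (-1) \<phi>))"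
    using MInfIn by (simp add: lipschitz_value_def abs_minus_commute)
  from lipschitz_value_MSupIn[OF this, of x y] show ?case
    unfolding mse_val_MInfIn[abs_def] lipschitz_value_uminus by (simp del: mse_val.simps)
qed

lemma mse_val_lipschitz_upd:
  assumes "valuation \<rho>" "a \<in> M" "b \<in> M"
  shows "\<bar>mse_val M d E \<phi> (\<rho>(x := a)) - mse_val M d E \<phi> (\<rho>(x := b))\<bar> \<le> 2 * mse_v \<phi> * d a b"
proof (rule lipschitz_valueD[OF lipschitz_value_mse_val])
  have "\<rho> i \<in> M" for i using assms(1) by auto
  then show "d ((\<rho>(x := a)) i) ((\<rho>(x := b)) i) \<le> d a b" for i by (cases "i = x") auto
qed (intro valuation_upd assms)+

section \<open>Excision for MSE-formulas implies excision for membership formulas\<close>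

text \<open>The atomic formula \<open>e(x, y)\<close> becomes the infimum of \<open>d(x, z)\<close> over \<open>z E y\<close>. As \<open>v\<close> of the matrix
is \<open>1\<close>, the default value for an empty extension is the correct one. The bound variable only has to
differ from \<open>x\<close>, since \<open>y\<close> lies outside its scope.\<close>
primrec mse_of_le :: "le_fm \<Rightarrow> mse_fm" where
  "mse_of_le LOne = MOne"
| "mse_of_le (LMem x y) = MInfIn (Suc x) y (MDist x (Suc x))"
| "mse_of_le (LAdd \<phi> \<psi>) = MAdd (mse_of_le \<phi>) (mse_of_le \<psi>)"
| "mse_of_le (LMax \<phi> \<psi>) = MMax (mse_of_le \<phi>) (mse_of_le \<psi>)"
| "mse_of_le (LMin \<phi> \<psi>) = MMin (mse_of_le \<phi>) (mse_of_le \<psi>)"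
| "mse_of_le (LScale q \<phi>) = MScale (of_rat q) (mse_of_le \<phi>)"
| "mse_of_le (LSup x \<phi>) = MSup x (mse_of_le \<phi>)"
| "mse_of_le (LInf x \<phi>) = MInf x (mse_of_le \<phi>)"

lemma mse_v_mse_of_le: "mse_v (mse_of_le \<phi>) = le_v \<phi>"
  by (induction \<phi>) auto

lemma mse_val_mse_of_le: "valuation \<rho> \<Longrightarrow> mse_val M d E (mse_of_le \<phi>) \<rho> = le_val M e \<phi> \<rho>"
proof (induction \<phi> arbitrary: \<rho>)
  case (LMem x y)
  then have "\<rho> x \<in> M" "\<rho> y \<in> M" by auto
  then show ?case by (simp add: e_eq e_of_def)
next
  case (LSup x \<phi>)
  show ?case unfolding mse_of_le.simps mse_val.simps le_val.simps
    by (intro SUP_cong refl LSup.IH valuation_upd LSup.prems)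
next
  case (LInf x \<phi>)
  show ?case unfolding mse_of_le.simps mse_val.simps le_val.simps
    by (intro INF_cong refl LInf.IH valuation_upd LInf.prems)
qed simp_all

lemma le_v_nonneg: "0 \<le> le_v \<phi>"
  using mse_v_nonneg[of "mse_of_le \<phi>"] by (simp add: mse_v_mse_of_le)

lemma abs_le_val_le: "valuation \<rho> \<Longrightarrow> \<bar>le_val M e \<phi> \<rho>\<bar> \<le> le_v \<phi>"
  using abs_mse_val_le[of \<rho> "mse_of_le \<phi>"] by (simp add: mse_v_mse_of_le mse_val_mse_of_le)

text \<open>The innermost expression of the excision axiom: how badly \<open>a\<close> witnesses that \<open>c\<close> fails to separate
\<open>{\<phi> < 0}\<close> from \<open>{\<phi> > 1}\<close>.\<close>
definition excision_defect :: "le_fm \<Rightarrow> nat \<Rightarrow> (nat \<Rightarrow> 'a) \<Rightarrow> 'a \<Rightarrow> 'a \<Rightarrow> real" where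
  "excision_defect \<phi> x \<rho> c a =
    max (min (e a c) (- le_val M e \<phi> (\<rho>(x := a))))
        (min (le_eps \<phi> - e a c) (le_val M e \<phi> (\<rho>(x := a)) - 1))"

text \<open>The last inequality is the point of the definition of \<open>\<epsilon>\<close>: moving by \<open>\<epsilon>\<close> changes the value of the
formula by at most \<open>1 / 3\<close>.\<close>
lemma le_eps_bounds: "0 < le_eps \<phi>" "le_eps \<phi> \<le> 1 / 3" "2 * le_v \<phi> * le_eps \<phi> \<le> 1 / 3"
  proof -
  show "0 < le_eps \<phi>" by (simp add: le_eps_def)
  show "le_eps \<phi> \<le> 1 / 3" unfolding le_eps_def by (intro divide_left_mono) auto
  have "2 * le_v \<phi> \<le> max (6 * le_v \<phi>) 3 / 3" by simp
  then have "2 * le_v \<phi> / max (6 * le_v \<phi>) 3 \<le> 1 / 3" by (simp add: pos_divide_le_eq)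
  then show "2 * le_v \<phi> * le_eps \<phi> \<le> 1 / 3" by (simp add: le_eps_def)
qed

lemma abs_excision_defect_le:
  assumes "valuation \<rho>" "c \<in> M" "a \<in> M"
  shows "\<bar>excision_defect \<phi> x \<rho> c a\<bar> \<le> le_v \<phi> + 2"
  using abs_le_val_le[OF valuation_upd[OF assms(1,3)], of \<phi> x] e_nonneg[OF assms(3,2)]
    e_le_1[OF assms(3,2)] le_eps_bounds[of \<phi>] le_v_nonneg[of \<phi>]
  unfolding excision_defect_def by (intro abs_max_le; linarith)

text \<open>All values are bounded, so the nested suprema and infima can be read as quantifiers.\<close>
lemma Le_excision_iff:
  "Le_excision M e \<longleftrightarrow>
    (\<forall>\<phi> x \<rho> \<delta>. valuation \<rho> \<longrightarrow> \<delta> > 0 \<longrightarrow> (\<exists>c\<in>M. \<forall>a\<in>M. excision_defect \<phi> x \<rho> c a \<le> \<delta>))"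
proof -
  have *: "(SUP \<rho>\<in>{\<rho>. valuation \<rho>}. INF c\<in>M. SUP a\<in>M. excision_defect \<phi> x \<rho> c a) \<le> 0 \<longleftrightarrow>
      (\<forall>\<rho> \<delta>. valuation \<rho> \<longrightarrow> \<delta> > 0 \<longrightarrow> (\<exists>c\<in>M. \<forall>a\<in>M. excision_defect \<phi> x \<rho> c a \<le> \<delta>))" for \<phi> x
  proof -
    let ?K = "le_v \<phi> + 2" and ?f = "excision_defect \<phi> x"
    have b1: "\<bar>SUP a\<in>M. ?f \<rho> c a\<bar> \<le> ?K" if "valuation \<rho>" "c \<in> M" for \<rho> c
      using that nonempty abs_excision_defect_le by (intro abs_SUP_le)
    have b2: "\<bar>INF c\<in>M. SUP a\<in>M. ?f \<rho> c a\<bar> \<le> ?K" if "valuation \<rho>" for \<rho>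
      using that nonempty b1 by (auto simp: INF_eq_minus_SUP intro!: abs_SUP_le)
    have bd0: "bdd_above (?f \<rho> c ` M)" if "valuation \<rho>" "c \<in> M" for \<rho> c
      using abs_excision_defect_le[OF that] by (intro bdd_aboveI[of _ ?K]) (auto simp: abs_le_iff)
    have bd1: "bdd_below ((\<lambda>c. SUP a\<in>M. ?f \<rho> c a) ` M)" if "valuation \<rho>" for \<rho>
      by (intro bdd_belowI[of _ "-?K"]) (use b1[OF that] in \<open>force simp: abs_le_iff\<close>)
    have bd2: "bdd_above ((\<lambda>\<rho>. INF c\<in>M. SUP a\<in>M. ?f \<rho> c a) ` {\<rho>. valuation \<rho>})"
      using b2 by (intro bdd_aboveI[of _ ?K]) (auto simp: abs_le_iff)
    obtain m where m: "m \<in> M" using nonempty by blast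
    have "{\<rho>. valuation \<rho>} \<noteq> {}" using m by (auto intro!: exI[of _ "\<lambda>_. m"])
    then have "(SUP \<rho>\<in>{\<rho>. valuation \<rho>}. INF c\<in>M. SUP a\<in>M. ?f \<rho> c a) \<le> 0 \<longleftrightarrow>
        (\<forall>\<rho>. valuation \<rho> \<longrightarrow> (INF c\<in>M. SUP a\<in>M. ?f \<rho> c a) \<le> 0)"
      using cSUP_le_iff[OF _ bd2] by simp
    also have "\<dots> \<longleftrightarrow> (\<forall>\<rho> \<delta>. valuation \<rho> \<longrightarrow> \<delta> > 0 \<longrightarrow> (\<exists>c\<in>M. \<forall>a\<in>M. ?f \<rho> c a \<le> \<delta>))"
    proof (intro iff_allI)
      fix \<rho>
      show "(valuation \<rho> \<longrightarrow> (INF c\<in>M. SUP a\<in>M. ?f \<rho> c a) \<le> 0) \<longleftrightarrow>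
          (\<forall>\<delta>. valuation \<rho> \<longrightarrow> \<delta> > 0 \<longrightarrow> (\<exists>c\<in>M. \<forall>a\<in>M. ?f \<rho> c a \<le> \<delta>))"
      proof (cases "valuation \<rho>")
        case True
        have le: "(SUP a\<in>M. ?f \<rho> c a) \<le> \<delta> \<longleftrightarrow> (\<forall>a\<in>M. ?f \<rho> c a \<le> \<delta>)" if "c \<in> M" for c \<delta>
          by (rule cSUP_le_iff[OF nonempty bd0[OF True that]])
        have less: "(INF c\<in>M. SUP a\<in>M. ?f \<rho> c a) < \<delta> \<longleftrightarrow> (\<exists>c\<in>M. (SUP a\<in>M. ?f \<rho> c a) < \<delta>)" for \<delta>
          by (rule cINF_less_iff[OF nonempty bd1[OF True]])
        show ?thesis
        proof (intro iffI allI impI)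
          fix \<delta> :: real assume "valuation \<rho> \<longrightarrow> (INF c\<in>M. SUP a\<in>M. ?f \<rho> c a) \<le> 0" "\<delta> > 0"
          then have "(INF c\<in>M. SUP a\<in>M. ?f \<rho> c a) < \<delta>" using True by linarith
          then obtain c where c: "c \<in> M" "(SUP a\<in>M. ?f \<rho> c a) < \<delta>" unfolding less by (elim bexE)
          then show "\<exists>c\<in>M. \<forall>a\<in>M. ?f \<rho> c a \<le> \<delta>"
            using iffD1[OF le[OF c(1)] less_imp_le[OF c(2)]] c(1) by blast
        next
          assume *: "\<forall>\<delta>. valuation \<rho> \<longrightarrow> \<delta> > 0 \<longrightarrow> (\<exists>c\<in>M. \<forall>a\<in>M. ?f \<rho> c a \<le> \<delta>)"
          show "(INF c\<in>M. SUP a\<in>M. ?f \<rho> c a) \<le> 0"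
          proof (rule field_le_epsilon)
            fix \<delta> :: real assume "\<delta> > 0"
            then obtain c where c: "c \<in> M" "\<forall>a\<in>M. ?f \<rho> c a \<le> \<delta>" using * True by blast
            have "(INF c\<in>M. SUP a\<in>M. ?f \<rho> c a) \<le> \<delta>"
              by (rule cINF_lower2[OF bd1[OF True] c(1)]) (rule iffD2[OF le[OF c(1)] c(2)])
            then show "(INF c\<in>M. SUP a\<in>M. ?f \<rho> c a) \<le> 0 + \<delta>" by simp
          qed
        qed
      qed simp
    qed
    finally show ?thesis .
  qed
  show ?thesis
    unfolding Le_excision_def by (fold excision_defect_def) (simp only: *)
qed

text \<open>Excise the translated formula between the levels \<open>0\<close> and \<open>2 / 3\<close>, leaving the margin \<open>1 / 3\<close> for
the Lipschitz estimate: a point within \<open>\<epsilon>\<close> of the excised set has value below \<open>2 / 3 + 1 / 3 = 1\<close>.\<close>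
lemma mse_excision_imp_Le_excision:
  assumes "mse_excision M d E"
  shows "Le_excision M e"
  unfolding Le_excision_iff
proof (intro allI impI)
  fix \<phi> x \<rho> and \<delta> :: real
  assume \<rho>: "valuation \<rho>" and "\<delta> > 0"
  let ?F = "\<lambda>a. le_val M e \<phi> (\<rho>(x := a))"
  have F: "mse_val M d E (mse_of_le \<phi>) (\<rho>(x := a)) = ?F a" if "a \<in> M" for a
    using that \<rho> by (intro mse_val_mse_of_le valuation_upd)
  have "\<exists>b\<in>M. \<forall>c\<in>M. (mse_val M d E (mse_of_le \<phi>) (\<rho>(x := c)) \<le> 0 \<longrightarrow> (c, b) \<in> E) \<and>
      ((c, b) \<in> E \<longrightarrow> mse_val M d E (mse_of_le \<phi>) (\<rho>(x := c)) < 2 / 3)"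
    using assms[unfolded mse_excision_def, rule_format, of 0 "2 / 3" \<rho> "mse_of_le \<phi>" x] \<rho> by simp
  then obtain b where b: "b \<in> M" "\<And>c. c \<in> M \<Longrightarrow> ?F c \<le> 0 \<Longrightarrow> (c, b) \<in> E"
    "\<And>c. c \<in> M \<Longrightarrow> (c, b) \<in> E \<Longrightarrow> ?F c < 2 / 3"
    using F by auto
  have "excision_defect \<phi> x \<rho> b a \<le> 0" if a: "a \<in> M" for a
  proof -
    have "e a b \<le> 0 \<or> - ?F a \<le> 0"
      using b(1,2) a e_eq_0_iff[of a b] by force
    moreover have "le_eps \<phi> \<le> e a b \<or> ?F a \<le> 1"
    proof (rule disjCI)
      assume "\<not> ?F a \<le> 1"
      show "le_eps \<phi> \<le> e a b"
      proof (rule ccontr)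
        assume "\<not> ?thesis"
        then obtain c where c: "(c, b) \<in> E" "d a c < le_eps \<phi>"
          using e_less_witness[of a b "le_eps \<phi>"] a b le_eps_bounds[of \<phi>] by auto
        then have "c \<in> M" using E_sub by auto
        have "\<bar>?F a - ?F c\<bar> \<le> 2 * le_v \<phi> * d a c"
          using mse_val_lipschitz_upd[OF \<rho> a \<open>c \<in> M\<close>, of "mse_of_le \<phi>" x] a \<open>c \<in> M\<close>
          by (simp add: F mse_v_mse_of_le)
        also have "\<dots> \<le> 2 * le_v \<phi> * le_eps \<phi>"
          using c le_v_nonneg[of \<phi>] by (intro mult_left_mono) auto
        finally show False
          using le_eps_bounds[of \<phi>] b(3)[OF \<open>c \<in> M\<close> c(1)] \<open>\<not> ?F a \<le> 1\<close> by linarith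
      qed
    qed
    ultimately show ?thesis unfolding excision_defect_def by (simp add: min_le_iff_disj)
  qed
  then have "\<forall>a\<in>M. excision_defect \<phi> x \<rho> b a \<le> \<delta>"
    by (meson \<open>\<delta> > 0\<close> less_imp_le order_trans)
  then show "\<exists>c\<in>M. \<forall>a\<in>M. excision_defect \<phi> x \<rho> c a \<le> \<delta>" using b(1) by blast
qed

end

section \<open>Approximating MSE-formulas by membership formulas\<close>

text \<open>Bound variables are renamed as well. For an injective renaming no variable is captured, so the
value is that of the original formula at the composed valuation.\<close>
primrec le_rename :: "(nat \<Rightarrow> nat) \<Rightarrow> le_fm \<Rightarrow> le_fm" where
  "le_rename \<sigma> LOne = LOne"
| "le_rename \<sigma> (LMem x y) = LMem (\<sigma> x) (\<sigma> y)"
| "le_rename \<sigma> (LAdd \<phi> \<psi>) = LAdd (le_rename \<sigma> \<phi>) (le_rename \<sigma> \<psi>)"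
| "le_rename \<sigma> (LMax \<phi> \<psi>) = LMax (le_rename \<sigma> \<phi>) (le_rename \<sigma> \<psi>)"
| "le_rename \<sigma> (LMin \<phi> \<psi>) = LMin (le_rename \<sigma> \<phi>) (le_rename \<sigma> \<psi>)"
| "le_rename \<sigma> (LScale q \<phi>) = LScale q (le_rename \<sigma> \<phi>)"
| "le_rename \<sigma> (LSup x \<phi>) = LSup (\<sigma> x) (le_rename \<sigma> \<phi>)"
| "le_rename \<sigma> (LInf x \<phi>) = LInf (\<sigma> x) (le_rename \<sigma> \<phi>)"

lemma le_val_rename:
  assumes "inj \<sigma>"
  shows "le_val M e (le_rename \<sigma> \<psi>) \<rho> = le_val M e \<psi> (\<rho> \<circ> \<sigma>)"
proof (induction \<psi> arbitrary: \<rho>)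
  have upd: "\<rho>(\<sigma> x := a) \<circ> \<sigma> = (\<rho> \<circ> \<sigma>)(x := a)" for \<rho> :: "nat \<Rightarrow> 'a" and x a
    using assms by (auto simp: fun_eq_iff inj_eq)
  {
    case (LSup x \<psi>)
    show ?case by (simp only: le_rename.simps le_val.simps LSup upd)
  next
    case (LInf x \<psi>)
    show ?case by (simp only: le_rename.simps le_val.simps LInf upd)
  }
qed simp_all

text \<open>This provides fresh variables.\<close>
lemma le_val_finite_support:
  "\<exists>N. \<forall>\<rho> \<rho>'. (\<forall>i<N. \<rho> i = \<rho>' i) \<longrightarrow> le_val M e \<psi> \<rho> = le_val M e \<psi> \<rho>'"
proof (induction \<psi>)
  case LOne
  show ?case by simp
next
  case (LMem x y)
  show ?case by (intro exI[of _ "Suc (max x y)"]) (simp add: less_Suc_eq_le)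
next
  case (LAdd \<phi> \<psi>)
  from LAdd obtain N1 N2 where
    N1: "\<And>\<rho> \<rho>'. (\<forall>i<N1. \<rho> i = \<rho>' i) \<Longrightarrow> le_val M e \<phi> \<rho> = le_val M e \<phi> \<rho>'" and
    N2: "\<And>\<rho> \<rho>'. (\<forall>i<N2. \<rho> i = \<rho>' i) \<Longrightarrow> le_val M e \<psi> \<rho> = le_val M e \<psi> \<rho>'" by blast
  show ?case
  proof (intro exI[of _ "max N1 N2"] allI impI)
    fix \<rho> \<rho>' :: "nat \<Rightarrow> 'a" assume "\<forall>i<max N1 N2. \<rho> i = \<rho>' i"
    then show "le_val M e (LAdd \<phi> \<psi>) \<rho> = le_val M e (LAdd \<phi> \<psi>) \<rho>'"
      using N1[of \<rho> \<rho>'] N2[of \<rho> \<rho>'] by simp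
  qed
next
  case (LMax \<phi> \<psi>)
  from LMax obtain N1 N2 where
    N1: "\<And>\<rho> \<rho>'. (\<forall>i<N1. \<rho> i = \<rho>' i) \<Longrightarrow> le_val M e \<phi> \<rho> = le_val M e \<phi> \<rho>'" and
    N2: "\<And>\<rho> \<rho>'. (\<forall>i<N2. \<rho> i = \<rho>' i) \<Longrightarrow> le_val M e \<psi> \<rho> = le_val M e \<psi> \<rho>'" by blast
  show ?case
  proof (intro exI[of _ "max N1 N2"] allI impI)
    fix \<rho> \<rho>' :: "nat \<Rightarrow> 'a" assume "\<forall>i<max N1 N2. \<rho> i = \<rho>' i"
    then show "le_val M e (LMax \<phi> \<psi>) \<rho> = le_val M e (LMax \<phi> \<psi>) \<rho>'"
      using N1[of \<rho> \<rho>'] N2[of \<rho> \<rho>'] by simp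
  qed
next
  case (LMin \<phi> \<psi>)
  from LMin obtain N1 N2 where
    N1: "\<And>\<rho> \<rho>'. (\<forall>i<N1. \<rho> i = \<rho>' i) \<Longrightarrow> le_val M e \<phi> \<rho> = le_val M e \<phi> \<rho>'" and
    N2: "\<And>\<rho> \<rho>'. (\<forall>i<N2. \<rho> i = \<rho>' i) \<Longrightarrow> le_val M e \<psi> \<rho> = le_val M e \<psi> \<rho>'" by blast
  show ?case
  proof (intro exI[of _ "max N1 N2"] allI impI)
    fix \<rho> \<rho>' :: "nat \<Rightarrow> 'a" assume "\<forall>i<max N1 N2. \<rho> i = \<rho>' i"
    then show "le_val M e (LMin \<phi> \<psi>) \<rho> = le_val M e (LMin \<phi> \<psi>) \<rho>'"
      using N1[of \<rho> \<rho>'] N2[of \<rho> \<rho>'] by simp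
  qed
next
  case (LScale q \<phi>)
  then obtain N where N: "\<And>\<rho> \<rho>'. (\<forall>i<N. \<rho> i = \<rho>' i) \<Longrightarrow> le_val M e \<phi> \<rho> = le_val M e \<phi> \<rho>'" by blast
  show ?case unfolding le_val.simps
    by (intro exI[of _ N] allI impI arg_cong[where f = "\<lambda>t. of_rat q * t"] N) blast
next
  case (LSup x \<phi>)
  then obtain N where N: "\<And>\<rho> \<rho>'. (\<forall>i<N. \<rho> i = \<rho>' i) \<Longrightarrow> le_val M e \<phi> \<rho> = le_val M e \<phi> \<rho>'" by blast
  show ?case unfolding le_val.simps
    by (intro exI[of _ N] allI impI SUP_cong refl N) simp
next
  case (LInf x \<phi>)
  then obtain N where N: "\<And>\<rho> \<rho>'. (\<forall>i<N. \<rho> i = \<rho>' i) \<Longrightarrow> le_val M e \<phi> \<rho> = le_val M e \<phi> \<rho>'" by blast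
  show ?case unfolding le_val.simps
    by (intro exI[of _ N] allI impI INF_cong refl N) simp
qed

context membership_structure
begin

text \<open>Real coefficients and real values of \<open>v\<close> can only be matched approximately by rational ones, so
translations of MSE-formulas are uniform limits.\<close>
definition approximable :: "((nat \<Rightarrow> 'a) \<Rightarrow> real) \<Rightarrow> bool" where
  "approximable f \<longleftrightarrow> (\<forall>\<delta>>0. \<exists>\<psi>. \<forall>\<rho>. valuation \<rho> \<longrightarrow> \<bar>le_val M e \<psi> \<rho> - f \<rho>\<bar> \<le> \<delta>)"

lemma approximableI:
  assumes "\<And>\<delta>. \<delta> > 0 \<Longrightarrow> \<exists>\<psi>. \<forall>\<rho>. valuation \<rho> \<longrightarrow> \<bar>le_val M e \<psi> \<rho> - f \<rho>\<bar> \<le> \<delta>"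
  shows "approximable f"
  using assms by (simp add: approximable_def)

lemma approximableE:
  assumes "approximable f" "\<delta> > 0"
  obtains \<psi> where "\<And>\<rho>. valuation \<rho> \<Longrightarrow> \<bar>le_val M e \<psi> \<rho> - f \<rho>\<bar> \<le> \<delta>"
  using assms unfolding approximable_def by blast

lemma approximable_exact:
  assumes "\<And>\<rho>. valuation \<rho> \<Longrightarrow> le_val M e \<psi> \<rho> = f \<rho>"
  shows "approximable f"
  using assms by (intro approximableI exI[of _ \<psi>]) simp

lemma approximable_add:
  assumes "approximable f" "approximable g"
  shows "approximable (\<lambda>\<rho>. f \<rho> + g \<rho>)"
proof (rule approximableI)
  fix \<delta> :: real assume "\<delta> > 0"
  then have "\<delta> / 2 > 0" by simp
  obtain \<phi> where \<phi>: "\<And>\<rho>. valuation \<rho> \<Longrightarrow> \<bar>le_val M e \<phi> \<rho> - f \<rho>\<bar> \<le> \<delta> / 2"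
    using approximableE[OF assms(1) \<open>\<delta> / 2 > 0\<close>] by blast
  obtain \<psi> where \<psi>: "\<And>\<rho>. valuation \<rho> \<Longrightarrow> \<bar>le_val M e \<psi> \<rho> - g \<rho>\<bar> \<le> \<delta> / 2"
    using approximableE[OF assms(2) \<open>\<delta> / 2 > 0\<close>] by blast
  have "\<bar>le_val M e (LAdd \<phi> \<psi>) \<rho> - (f \<rho> + g \<rho>)\<bar> \<le> \<delta>" if "valuation \<rho>" for \<rho>
    using \<phi>[OF that] \<psi>[OF that] unfolding le_val.simps by linarith
  then show "\<exists>\<psi>. \<forall>\<rho>. valuation \<rho> \<longrightarrow> \<bar>le_val M e \<psi> \<rho> - (f \<rho> + g \<rho>)\<bar> \<le> \<delta>" by blast
qed

lemma approximable_max_min: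
  assumes "approximable f" "approximable g"
  shows "approximable (\<lambda>\<rho>. max (f \<rho>) (g \<rho>))" "approximable (\<lambda>\<rho>. min (f \<rho>) (g \<rho>))"
proof -
  have *: "\<exists>\<phi> \<psi>. \<forall>\<rho>. valuation \<rho> \<longrightarrow> \<bar>le_val M e \<phi> \<rho> - f \<rho>\<bar> \<le> \<delta> \<and> \<bar>le_val M e \<psi> \<rho> - g \<rho>\<bar> \<le> \<delta>"
    if "\<delta> > 0" for \<delta>
    using approximableE[OF assms(1) that] approximableE[OF assms(2) that] by metis
  show "approximable (\<lambda>\<rho>. max (f \<rho>) (g \<rho>))"
  proof (rule approximableI)
    fix \<delta> :: real assume "\<delta> > 0"
    from *[OF this] obtain \<phi> \<psi> where "\<forall>\<rho>. valuation \<rho> \<longrightarrow>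
      \<bar>le_val M e \<phi> \<rho> - f \<rho>\<bar> \<le> \<delta> \<and> \<bar>le_val M e \<psi> \<rho> - g \<rho>\<bar> \<le> \<delta>" by blast
    then show "\<exists>\<psi>. \<forall>\<rho>. valuation \<rho> \<longrightarrow> \<bar>le_val M e \<psi> \<rho> - max (f \<rho>) (g \<rho>)\<bar> \<le> \<delta>"
      by (intro exI[of _ "LMax \<phi> \<psi>"]) (simp add: abs_max_diff_le)
  qed
  show "approximable (\<lambda>\<rho>. min (f \<rho>) (g \<rho>))"
  proof (rule approximableI)
    fix \<delta> :: real assume "\<delta> > 0"
    from *[OF this] obtain \<phi> \<psi> where "\<forall>\<rho>. valuation \<rho> \<longrightarrow>
      \<bar>le_val M e \<phi> \<rho> - f \<rho>\<bar> \<le> \<delta> \<and> \<bar>le_val M e \<psi> \<rho> - g \<rho>\<bar> \<le> \<delta>" by blast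
    then show "\<exists>\<psi>. \<forall>\<rho>. valuation \<rho> \<longrightarrow> \<bar>le_val M e \<psi> \<rho> - min (f \<rho>) (g \<rho>)\<bar> \<le> \<delta>"
      by (intro exI[of _ "LMin \<phi> \<psi>"]) (simp add: abs_max_diff_le)
  qed
qed

lemma approximable_scale:
  assumes "approximable f" and f: "\<And>\<rho>. valuation \<rho> \<Longrightarrow> \<bar>f \<rho>\<bar> \<le> v" and "v \<ge> 0"
  shows "approximable (\<lambda>\<rho>. r * f \<rho>)"
proof (rule approximableI)
  fix \<delta> :: real assume "\<delta> > 0"
  define \<eta> where "\<eta> = min 1 (\<delta> / (2 * (v + 1)))"
  have "\<eta> > 0" using \<open>\<delta> > 0\<close> \<open>v \<ge> 0\<close> by (simp add: \<eta>_def)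
  then obtain q where "r < of_rat q" "of_rat q < r + \<eta>" using of_rat_dense[of r "r + \<eta>"] by auto
  then have q: "\<bar>of_rat q\<bar> \<le> \<bar>r\<bar> + 1" "\<bar>of_rat q - r\<bar> \<le> \<delta> / (2 * (v + 1))"
    unfolding \<eta>_def by linarith+
  have "\<delta> / (2 * (\<bar>r\<bar> + 1)) > 0" using \<open>\<delta> > 0\<close> by (simp add: add_nonneg_pos)
  then obtain \<psi> where \<psi>: "\<And>\<rho>. valuation \<rho> \<Longrightarrow> \<bar>le_val M e \<psi> \<rho> - f \<rho>\<bar> \<le> \<delta> / (2 * (\<bar>r\<bar> + 1))"
    using approximableE[OF assms(1)] by blast
  have "\<bar>le_val M e (LScale q \<psi>) \<rho> - r * f \<rho>\<bar> \<le> \<delta>" if \<rho>: "valuation \<rho>" for \<rho>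
  proof -
    let ?L = "le_val M e \<psi> \<rho>" and ?F = "f \<rho>" and ?q = "of_rat q :: real"
    have "?q * ?L - r * ?F = ?q * (?L - ?F) + (?q - r) * ?F" by (simp add: algebra_simps)
    then have "\<bar>?q * ?L - r * ?F\<bar> \<le> \<bar>?q\<bar> * \<bar>?L - ?F\<bar> + \<bar>?q - r\<bar> * \<bar>?F\<bar>"
      by (metis abs_mult abs_triangle_ineq)
    also have "\<bar>?q\<bar> * \<bar>?L - ?F\<bar> \<le> (\<bar>r\<bar> + 1) * (\<delta> / (2 * (\<bar>r\<bar> + 1)))"
      by (rule mult_mono[OF q(1) \<psi>[OF \<rho>]]) auto
    also have "\<dots> = \<delta> / 2" by (simp add: field_simps)
    also have "\<bar>?q - r\<bar> * \<bar>?F\<bar> \<le> \<delta> / (2 * (v + 1)) * (v + 1)"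
      using q(2)
    proof (rule mult_mono)
      show "\<bar>?F\<bar> \<le> v + 1" using f[OF \<rho>] by linarith
    qed (use \<open>\<delta> > 0\<close> \<open>v \<ge> 0\<close> in auto)
    also have "\<dots> = \<delta> / 2" using \<open>v \<ge> 0\<close> by (simp add: field_simps)
    finally show ?thesis by simp
  qed
  then show "\<exists>\<psi>. \<forall>\<rho>. valuation \<rho> \<longrightarrow> \<bar>le_val M e \<psi> \<rho> - r * f \<rho>\<bar> \<le> \<delta>" by blast
qed

lemma approximable_uminus:
  assumes "approximable f"
  shows "approximable (\<lambda>\<rho>. - f \<rho>)"
proof (rule approximableI)
  fix \<delta> :: real assume "\<delta> > 0"
  then obtain \<psi> where \<psi>: "\<And>\<rho>. valuation \<rho> \<Longrightarrow> \<bar>le_val M e \<psi> \<rho> - f \<rho>\<bar> \<le> \<delta>"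
    using approximableE[OF assms] by blast
  have "\<bar>le_val M e (LScale (-1) \<psi>) \<rho> - - f \<rho>\<bar> \<le> \<delta>" if "valuation \<rho>" for \<rho>
    using \<psi>[OF that] by (simp add: of_rat_minus)
  then show "\<exists>\<psi>. \<forall>\<rho>. valuation \<rho> \<longrightarrow> \<bar>le_val M e \<psi> \<rho> - - f \<rho>\<bar> \<le> \<delta>" by blast
qed

lemma approximable_SUP:
  assumes "approximable f" and f: "\<And>\<rho>. valuation \<rho> \<Longrightarrow> \<bar>f \<rho>\<bar> \<le> v"
  shows "approximable (\<lambda>\<rho>. SUP a\<in>M. f (\<rho>(x := a)))"
proof (rule approximableI)
  fix \<delta> :: real assume "\<delta> > 0"
  then obtain \<psi> where \<psi>: "\<And>\<rho>. valuation \<rho> \<Longrightarrow> \<bar>le_val M e \<psi> \<rho> - f \<rho>\<bar> \<le> \<delta>"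
    using approximableE[OF assms(1)] by blast
  have "\<bar>le_val M e (LSup x \<psi>) \<rho> - (SUP a\<in>M. f (\<rho>(x := a)))\<bar> \<le> \<delta>" if \<rho>: "valuation \<rho>" for \<rho>
    unfolding le_val.simps
  proof (rule abs_SUP_diff_le[OF nonempty nonempty])
    fix a assume a: "a \<in> M"
    note \<rho>a = valuation_upd[OF \<rho> a]
    show "\<bar>le_val M e \<psi> (\<rho>(x := a))\<bar> \<le> le_v \<psi>" by (intro abs_le_val_le \<rho>a)
    show "\<bar>f (\<rho>(x := a))\<bar> \<le> v" by (intro f \<rho>a)
    show "\<exists>b\<in>M. \<bar>le_val M e \<psi> (\<rho>(x := a)) - f (\<rho>(x := b))\<bar> \<le> \<delta>"
      "\<exists>b\<in>M. \<bar>le_val M e \<psi> (\<rho>(x := b)) - f (\<rho>(x := a))\<bar> \<le> \<delta>"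
      using \<psi>[OF \<rho>a] a by blast+
  qed
  then show "\<exists>\<psi>. \<forall>\<rho>. valuation \<rho> \<longrightarrow> \<bar>le_val M e \<psi> \<rho> - (SUP a\<in>M. f (\<rho>(x := a)))\<bar> \<le> \<delta>" by blast
qed

lemma approximable_MSup:
  assumes "approximable (mse_val M d E \<phi>)"
  shows "approximable (mse_val M d E (MSup x \<phi>))"
proof -
  have "mse_val M d E (MSup x \<phi>) = (\<lambda>\<rho>. SUP a\<in>M. mse_val M d E \<phi> (\<rho>(x := a)))"
    by (rule ext) (rule mse_val.simps)
  then show ?thesis using approximable_SUP[OF assms abs_mse_val_le] by (simp only:)
qed

lemma approximable_d: "approximable (\<lambda>\<rho>. d (\<rho> x) (\<rho> y))"
proof -
  let ?z = "Suc (x + y)"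
  let ?\<psi> = "LSup ?z (LMax (LAdd (LMem ?z x) (LScale (-1) (LMem ?z y)))
                       (LScale (-1) (LAdd (LMem ?z x) (LScale (-1) (LMem ?z y)))))"
  show ?thesis
  proof (rule approximable_exact[of ?\<psi>])
    fix \<rho> assume "valuation \<rho>"
    then have "\<rho> x \<in> M" "\<rho> y \<in> M" by auto
    have "le_val M e ?\<psi> \<rho> = (SUP a\<in>M. \<bar>e a (\<rho> x) - e a (\<rho> y)\<bar>)"
      unfolding le_val.simps by (intro SUP_cong refl) (simp add: of_rat_minus abs_if max_def)
    then show "le_val M e ?\<psi> \<rho> = d (\<rho> x) (\<rho> y)"
      using d_eq[OF \<open>\<rho> x \<in> M\<close> \<open>\<rho> y \<in> M\<close>] \<open>\<rho> x \<in> M\<close> \<open>\<rho> y \<in> M\<close> by (simp add: d_of_def)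
  qed
qed

text \<open>Why bounded suprema are unbounded ones: by Lipschitz continuity, leaving the extension by the
distance \<open>e a y\<close> gains at most \<open>2 * v * e a y\<close>, so subtracting this penalty allows the
supremum to range over all of \<open>M\<close>.\<close>
lemma bounded_sup_penalty:
  assumes \<rho>: "valuation \<rho>" and ne: "extension E (\<rho> y) \<noteq> {}" and "a \<in> M"
  shows "mse_val M d E \<phi> (\<rho>(x := a)) \<le>
           mse_val M d E (MSupIn x y \<phi>) \<rho> + 2 * mse_v \<phi> * e a (\<rho> y)"
proof -
  let ?F = "\<lambda>a. mse_val M d E \<phi> (\<rho>(x := a))" and ?G = "mse_val M d E (MSupIn x y \<phi>) \<rho>"
  have y: "\<rho> y \<in> M" using \<rho> by auto
  have G: "?F z \<le> ?G" if "z \<in> extension E (\<rho> y)" for z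
  proof -
    have "bdd_above (?F ` extension E (\<rho> y))"
    proof (rule bdd_aboveI2)
      show "?F z \<le> mse_v \<phi>" if "z \<in> extension E (\<rho> y)" for z
        using abs_mse_val_le[OF valuation_upd_extension[OF \<rho> that], of \<phi> x] by linarith
    qed
    then show ?thesis unfolding mse_val.simps if_not_P[OF ne] by (rule cSUP_upper[OF that])
  qed
  have "?F a - ?G \<le> 2 * mse_v \<phi> * e_of d E a (\<rho> y)"
  proof (rule le_mult_e_of)
    show "?F a - ?G \<le> 2 * mse_v \<phi>"
      using abs_mse_val_le[OF valuation_upd[OF \<rho> \<open>a \<in> M\<close>], of \<phi> x]
        abs_mse_val_le[OF \<rho>, of "MSupIn x y \<phi>"] unfolding mse_v.simps by linarith
    fix z assume z: "(z, \<rho> y) \<in> E"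
    then have "z \<in> M" using E_sub by auto
    then show "?F a - ?G \<le> 2 * mse_v \<phi> * d a z"
      using mse_val_lipschitz_upd[OF \<rho> \<open>a \<in> M\<close> \<open>z \<in> M\<close>, of \<phi> x] G[of z] z
      by (simp add: extension_def del: mse_val.simps)
  qed (simp add: mse_v_nonneg)
  then show ?thesis using e_eq[OF \<open>a \<in> M\<close> y] by simp
qed

text \<open>The approximating formula is \<open>max (- q) (sup w. \<psi>(w) - k * e(w, y))\<close> with rational \<open>q\<close> slightly above
\<open>v\<close>. If the extension of \<open>y\<close> is nonempty, then the supremum is the bounded supremum up to the
approximation error, because \<open>k\<close> exceeds the Lipschitz constant. If it is empty, then \<open>e(w, y) = 1\<close>
and \<open>k\<close> is large enough to push the supremum below \<open>- q\<close>, so the result is close to the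
default value \<open>- v\<close>.\<close>
lemma approximable_MSupIn:
  assumes "approximable (mse_val M d E \<phi>)"
  shows "approximable (mse_val M d E (MSupIn x y \<phi>))"
proof (rule approximableI)
  fix \<delta> :: real assume "\<delta> > 0"
  let ?v = "mse_v \<phi>"
  obtain \<psi> where \<psi>: "\<And>\<rho>. valuation \<rho> \<Longrightarrow> \<bar>le_val M e \<psi> \<rho> - mse_val M d E \<phi> \<rho>\<bar> \<le> \<delta>"
    using approximableE[OF assms \<open>\<delta> > 0\<close>] by blast
  obtain N where N: "\<And>\<rho> \<rho>'. (\<forall>i<N. \<rho> i = \<rho>' i) \<Longrightarrow> le_val M e \<psi> \<rho> = le_val M e \<psi> \<rho>'"
    using le_val_finite_support[of M e \<psi>] by blast
  \<comment> \<open>A fresh variable is essential if \<open>x = y\<close>: then \<open>x\<close> occurs both bound in the matrix and free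
    in the bound of the quantifier.\<close>
  define w where "w = Suc (N + x + y)"
  define \<sigma> where "\<sigma> = id(x := w, w := x)"
  have w: "w \<noteq> x" "w \<noteq> y" "N \<le> w" by (auto simp: w_def)
  have "inj \<sigma>" using w by (auto simp: inj_def \<sigma>_def)
  obtain q where q: "?v < of_rat q" "of_rat q < ?v + \<delta>"
    using of_rat_dense[of ?v "?v + \<delta>"] \<open>\<delta> > 0\<close> by auto
  obtain k where k: "2 * ?v + 2 * \<delta> < of_rat k"
    using of_rat_dense[of "2 * ?v + 2 * \<delta>" "2 * ?v + 2 * \<delta> + 1"] by auto
  let ?\<chi> = "LMax (LScale (- q) LOne) (LSup w (LAdd (le_rename \<sigma> \<psi>) (LScale (- k) (LMem w y))))"
  have "\<bar>le_val M e ?\<chi> \<rho> - mse_val M d E (MSupIn x y \<phi>) \<rho>\<bar> \<le> \<delta>" if \<rho>: "valuation \<rho>" for \<rho>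
  proof -
    let ?L = "\<lambda>a. le_val M e \<psi> (\<rho>(x := a))" and ?F = "\<lambda>a. mse_val M d E \<phi> (\<rho>(x := a))"
    let ?S = "SUP a\<in>M. ?L a - of_rat k * e a (\<rho> y)" and ?G = "mse_val M d E (MSupIn x y \<phi>) \<rho>"
    have y: "\<rho> y \<in> M" using \<rho> by auto
    have "le_val M e (le_rename \<sigma> \<psi>) (\<rho>(w := a)) = ?L a" for a
      unfolding le_val_rename[OF \<open>inj \<sigma>\<close>]
      by (rule N) (use w in \<open>auto simp: \<sigma>_def\<close>)
    then have val: "le_val M e ?\<chi> \<rho> = max (- of_rat q) ?S"
      using w by (simp add: of_rat_minus)
    have L: "\<bar>?L a - ?F a\<bar> \<le> \<delta>" and F: "\<bar>?F a\<bar> \<le> ?v" if "a \<in> M" for a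
      by (rule \<psi>[OF valuation_upd[OF \<rho> that]], rule abs_mse_val_le[OF valuation_upd[OF \<rho> that]])
    have G: "\<bar>?G\<bar> \<le> ?v" using abs_mse_val_le[OF \<rho>, of "MSupIn x y \<phi>"] by (simp only: mse_v.simps)
    have ke: "0 \<le> of_rat k * e a (\<rho> y)" "2 * ?v * e a (\<rho> y) \<le> of_rat k * e a (\<rho> y)" if "a \<in> M" for a
    proof -
      show "2 * ?v * e a (\<rho> y) \<le> of_rat k * e a (\<rho> y)"
        using k \<open>\<delta> > 0\<close> e_nonneg[OF that y] by (intro mult_right_mono) auto
      moreover have "0 \<le> 2 * ?v * e a (\<rho> y)" using e_nonneg[OF that y] mse_v_nonneg[of \<phi>] by simp
      ultimately show "0 \<le> of_rat k * e a (\<rho> y)" by linarith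
    qed
    show ?thesis
    proof (cases "extension E (\<rho> y) = {}")
      case True
      have "?S \<le> - of_rat q"
      proof (rule cSUP_least[OF nonempty])
        fix a assume a: "a \<in> M"
        have "e a (\<rho> y) = 1" using e_eq[OF a y] e_of_empty[OF True] by simp
        then show "?L a - of_rat k * e a (\<rho> y) \<le> - of_rat q"
          using L[OF a] F[OF a] k q by simp
      qed
      then show ?thesis using True q unfolding val by simp
    next
      case False
      have "?S \<le> ?G + \<delta>"
      proof (rule cSUP_least[OF nonempty])
        fix a assume a: "a \<in> M"
        show "?L a - of_rat k * e a (\<rho> y) \<le> ?G + \<delta>"
          using bounded_sup_penalty[OF \<rho> False a, of \<phi> x] L[OF a] ke[OF a] by linarith
      qed
      moreover have "?G \<le> ?S + \<delta>"
        unfolding mse_val.simps if_not_P[OF False]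
      proof (rule cSUP_least[OF False])
        fix z assume z: "z \<in> extension E (\<rho> y)"
        then have "z \<in> M" "e z (\<rho> y) = 0"
          using extension_sub e_eq_0_iff[of z "\<rho> y"] y by (auto simp: extension_def)
        have "bdd_above ((\<lambda>a. ?L a - of_rat k * e a (\<rho> y)) ` M)"
        proof (rule bdd_aboveI2)
          show "?L a - of_rat k * e a (\<rho> y) \<le> ?v + \<delta>" if "a \<in> M" for a
            using L[OF that] F[OF that] ke[OF that] by linarith
        qed
        then have "?L z - of_rat k * e z (\<rho> y) \<le> ?S" by (rule cSUP_upper[OF \<open>z \<in> M\<close>])
        then show "?F z \<le> ?S + \<delta>" using L[OF \<open>z \<in> M\<close>] \<open>e z (\<rho> y) = 0\<close> by simp
      qed
      ultimately show ?thesis using G q unfolding val by linarith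
    qed
  qed
  then show "\<exists>\<psi>. \<forall>\<rho>. valuation \<rho> \<longrightarrow> \<bar>le_val M e \<psi> \<rho> - mse_val M d E (MSupIn x y \<phi>) \<rho>\<bar> \<le> \<delta>" by blast
qed

lemma mse_val_neg: "mse_val M d E (MScale (-1) \<phi>) = (\<lambda>\<rho>. - mse_val M d E \<phi> \<rho>)"
  by (rule ext) simp

lemma approximable_mse_val: "approximable (mse_val M d E \<phi>)"
proof (induction \<phi>)
  case MOne
  show ?case by (rule approximable_exact[of LOne]) simp
next
  case (MDist x y)
  show ?case using approximable_d[of x y] by simp
next
  case (MAdd \<phi> \<psi>)
  then show ?case using approximable_add by simp
next
  case (MMax \<phi> \<psi>)
  then show ?case using approximable_max_min by simp
next
  case (MMin \<phi> \<psi>)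
  then show ?case using approximable_max_min by simp
next
  case (MScale r \<phi>)
  show ?case using approximable_scale[OF MScale abs_mse_val_le mse_v_nonneg, of r] by simp
next
  case (MSup x \<phi>)
  then show ?case by (rule approximable_MSup)
next
  case (MInf x \<phi>)
  have "approximable (mse_val M d E (MScale (-1) \<phi>))"
    using approximable_uminus[OF MInf] unfolding mse_val_neg .
  from approximable_uminus[OF approximable_MSup[OF this, of x]] show ?case
    unfolding mse_val_MInf[abs_def] .
next
  case (MSupIn x y \<phi>)
  show ?case using MSupIn by (rule approximable_MSupIn)
next
  case (MInfIn x y \<phi>)
  have "approximable (mse_val M d E (MScale (-1) \<phi>))"
    using approximable_uminus[OF MInfIn] unfolding mse_val_neg .
  from approximable_uminus[OF approximable_MSupIn[OF this, of x y]] show ?case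
    unfolding mse_val_MInfIn[abs_def] .
qed

section \<open>From approximate to exact excision\<close>

lemma excision_defect_le_iff:
  "excision_defect \<phi> x \<rho> c a \<le> t \<longleftrightarrow>
     (e a c \<le> t \<or> - le_val M e \<phi> (\<rho>(x := a)) \<le> t) \<and>
     (le_eps \<phi> - e a c \<le> t \<or> le_val M e \<phi> (\<rho>(x := a)) - 1 \<le> t)"
  unfolding excision_defect_def max.bounded_iff min_le_iff_disj ..

text \<open>Rescaling \<open>\<psi>\<close> to \<open>k * (\<psi> - q)\<close>, with \<open>q\<close> between \<open>r\<close> and \<open>s\<close> and \<open>k\<close> large, moves the levels
\<open>r\<close> and \<open>s\<close> to at most \<open>- 2\<close> and at least \<open>2\<close>, safely outside the interval from \<open>0\<close> to \<open>1\<close> of the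
axiom. The inclusion of the sublevel set in the excised set is only approximate, but the error \<open>\<delta>\<close>
is arbitrary.\<close>
lemma Le_excision_separates:
  assumes "Le_excision M e" "valuation \<rho>" "r < s" "\<delta> > 0"
  shows "\<exists>c\<in>M. \<forall>a\<in>M. (le_val M e \<psi> (\<rho>(x := a)) \<le> r \<longrightarrow> e a c \<le> \<delta>) \<and>
                       (s \<le> le_val M e \<psi> (\<rho>(x := a)) \<longrightarrow> 0 < e a c)"
proof -
  obtain q where q: "r < of_rat q" "of_rat q < s" using of_rat_dense[OF \<open>r < s\<close>] by auto
  define h where "h = min (of_rat q - r) (s - of_rat q)"
  have "h > 0" using q by (simp add: h_def)
  obtain k where k: "2 / h < of_rat k" using of_rat_dense[of "2 / h" "2 / h + 1"] by auto
  moreover have "2 / h > 0" using \<open>h > 0\<close> by simp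
  ultimately have "of_rat k > (0::real)" by linarith
  have kh: "2 \<le> of_rat k * h" using k \<open>h > 0\<close> by (simp add: pos_divide_less_eq)
  let ?\<chi> = "LScale k (LAdd \<psi> (LScale (- q) LOne))"
  let ?L = "\<lambda>a. le_val M e \<psi> (\<rho>(x := a))" and ?X = "\<lambda>a. le_val M e ?\<chi> (\<rho>(x := a))"
  have X: "?X a = of_rat k * (?L a - of_rat q)" for a by (simp add: of_rat_minus)
  define \<delta>' where "\<delta>' = min \<delta> (min (1 / 2) (le_eps ?\<chi> / 2))"
  have \<delta>': "\<delta>' \<le> \<delta>" "\<delta>' \<le> 1 / 2" "\<delta>' \<le> le_eps ?\<chi> / 2" "\<delta>' > 0"
    using \<open>\<delta> > 0\<close> le_eps_bounds(1)[of ?\<chi>] unfolding \<delta>'_def by (simp_all del: le_v.simps)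
  have "\<exists>c\<in>M. \<forall>a\<in>M. excision_defect ?\<chi> x \<rho> c a \<le> \<delta>'"
    using assms(1) \<open>valuation \<rho>\<close> \<delta>'(4) unfolding Le_excision_iff by (elim allE impE)
  then obtain c where c: "c \<in> M" "\<forall>a\<in>M. excision_defect ?\<chi> x \<rho> c a \<le> \<delta>'" by (elim bexE)
  have "e a c \<le> \<delta>" if a: "a \<in> M" "?L a \<le> r" for a
  proof -
    have "?L a - of_rat q \<le> - h" using a(2) unfolding h_def by linarith
    then have "?X a \<le> of_rat k * (- h)"
      unfolding X by (rule mult_left_mono) (rule less_imp_le[OF \<open>of_rat k > 0\<close>])
    then have "?X a \<le> - 2" using kh by linarith
    moreover have "e a c \<le> \<delta>' \<or> - ?X a \<le> \<delta>'"
      using bspec[OF c(2) a(1)] unfolding excision_defect_le_iff by (rule conjunct1)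
    ultimately show ?thesis using \<delta>'(1,2) by linarith
  qed
  moreover have "0 < e a c" if a: "a \<in> M" "s \<le> ?L a" for a
  proof -
    have "h \<le> ?L a - of_rat q" using a(2) unfolding h_def by linarith
    then have "of_rat k * h \<le> ?X a"
      unfolding X by (rule mult_left_mono) (rule less_imp_le[OF \<open>of_rat k > 0\<close>])
    then have "2 \<le> ?X a" using kh by linarith
    moreover have "le_eps ?\<chi> - e a c \<le> \<delta>' \<or> ?X a - 1 \<le> \<delta>'"
      using bspec[OF c(2) a(1)] unfolding excision_defect_le_iff by (rule conjunct2)
    ultimately show ?thesis using \<delta>'(2,3) le_eps_bounds(1)[of ?\<chi>] by linarith
  qed
  ultimately show ?thesis using c(1) by blast
qed

text \<open>Turns membership up to the error \<open>\<delta>\<close> into exact membership. Excising the formula \<open>e(x, b)\<close> between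
\<open>s\<close> and \<open>2 * s\<close> gives \<open>c\<close> such that everything within \<open>s\<close> of \<open>b\<close> is within \<open>s / 2\<close> of \<open>c\<close>, while
the members of \<open>c\<close> are within \<open>2 * s\<close> of \<open>b\<close>; so \<open>d b c \<le> 2 * s\<close>. Starting at \<open>p\<close> with \<open>s = \<delta>\<close> and
iterating, the sets converge, and in the limit the error is \<open>0\<close>.\<close>
lemma Le_excision_thickening:
  assumes exc: "Le_excision M e" and "p \<in> M" "\<delta> > 0"
  shows "\<exists>b\<in>M. d p b \<le> 4 * \<delta> \<and> (\<forall>a\<in>M. e a p \<le> \<delta> \<longrightarrow> (a, b) \<in> E)"
proof -
  have step: "\<exists>c\<in>M. (\<forall>a\<in>M. e a b \<le> s \<longrightarrow> e a c \<le> s / 2) \<and> d b c \<le> 2 * s" if "b \<in> M" "s > 0" for b s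
  proof -
    have "valuation (\<lambda>_. b)" using \<open>b \<in> M\<close> by auto
    have "s < 2 * s" "s / 2 > 0" using \<open>s > 0\<close> by auto
    from Le_excision_separates[OF exc \<open>valuation (\<lambda>_. b)\<close> this, of "LMem 0 1" 0]
    obtain c where c: "c \<in> M" "\<forall>a\<in>M. (e a b \<le> s \<longrightarrow> e a c \<le> s / 2) \<and> (2 * s \<le> e a b \<longrightarrow> 0 < e a c)"
      by auto
    then have c1: "e a b \<le> s \<Longrightarrow> e a c \<le> s / 2" and c2: "2 * s \<le> e a b \<Longrightarrow> 0 < e a c" if "a \<in> M" for a
      using that by blast+
    have "d b c \<le> 2 * s"
    proof (rule d_le_if_extension_close[OF \<open>b \<in> M\<close> c(1)])
      fix a assume a: "(a, c) \<in> E"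
      then have "a \<in> M" using E_sub by auto
      then have "\<not> 0 < e a c" using a e_eq_0_iff[of a c] c(1) by simp
      then show "e a b \<le> 2 * s" using c2[OF \<open>a \<in> M\<close>] by linarith
    next
      fix a assume a: "(a, b) \<in> E"
      then have "a \<in> M" using E_sub by auto
      then have "e a b = 0" using a e_eq_0_iff[of a b] \<open>b \<in> M\<close> by simp
      then show "e a c \<le> 2 * s" using c1[OF \<open>a \<in> M\<close>] \<open>s > 0\<close> by linarith
    qed (use \<open>s > 0\<close> in simp)
    then show ?thesis using c(1) c1 by blast
  qed
  define P where "P b s \<longleftrightarrow> (\<forall>a\<in>M. e a p \<le> \<delta> \<longrightarrow> e a b \<le> s)" for b s
  obtain b where b: "b \<in> M" "d p b \<le> 2 * 2 * \<delta>"
    and lim: "\<And>\<eta>. \<eta> > 0 \<Longrightarrow> \<exists>c\<in>M. \<exists>s>0. s < \<eta> \<and> d c b < \<eta> \<and> P c s"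
  proof (rule mcomplete_iteration[OF complete \<open>p \<in> M\<close>, where P = P and t = \<delta> and c = 2])
    show "P p \<delta>" by (simp add: P_def)
    show "\<exists>c\<in>M. P c (s / 2) \<and> d b c \<le> 2 * s" if "b \<in> M" "s > 0" "P b s" for b s
      using step[OF that(1,2)] that(3) unfolding P_def by blast
  qed (use \<open>\<delta> > 0\<close> in auto)
  have "(a, b) \<in> E" if a: "a \<in> M" "e a p \<le> \<delta>" for a
  proof -
    have "e a b \<le> 0"
    proof (rule field_le_epsilon)
      fix \<eta> :: real assume "\<eta> > 0"
      then have "\<eta> / 2 > 0" by simp
      then obtain c s where "c \<in> M" "s < \<eta> / 2" "d c b < \<eta> / 2" "P c s" using lim by blast
      then show "e a b \<le> 0 + \<eta>"
        using e_diff_le_d[OF \<open>c \<in> M\<close> b(1) a(1)] \<open>P c s\<close>[unfolded P_def, rule_format, OF a] by linarith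
    qed
    then show ?thesis using e_nonneg[OF a(1) b(1)] e_eq_0_iff[OF a(1) b(1)] by linarith
  qed
  moreover have "d p b \<le> 4 * \<delta>" using b(2) by simp
  ultimately show ?thesis using b(1) by blast
qed

text \<open>The interval from \<open>r\<close> to \<open>s\<close> is cut into eight pieces of length \<open>h\<close>. Two of them cover the
approximation by \<open>\<psi>\<close> with error \<open>h\<close> at both ends, two the excision of \<open>\<psi>\<close> between \<open>r + h\<close> and
\<open>r + 3 * h\<close>, and one the thickening of \<open>p\<close> to \<open>b\<close>, during which the value grows by at most \<open>h\<close> by
Lipschitz continuity. The rest is slack.\<close>
lemma Le_excision_imp_mse_excision:
  assumes exc: "Le_excision M e"
  shows "mse_excision M d E"
  unfolding mse_excision_def
proof (intro allI impI)
  fix \<phi> x and r s :: real and \<rho>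
  assume "r < s" and \<rho>: "valuation \<rho>"
  let ?F = "\<lambda>a. mse_val M d E \<phi> (\<rho>(x := a))"
  define h where "h = (s - r) / 8"
  have s: "s = r + 8 * h" unfolding h_def by (simp add: field_simps)
  then have "h > 0" using \<open>r < s\<close> by linarith
  obtain \<psi> where \<psi>: "\<And>\<rho>. valuation \<rho> \<Longrightarrow> \<bar>le_val M e \<psi> \<rho> - mse_val M d E \<phi> \<rho>\<bar> \<le> h"
    using approximableE[OF approximable_mse_val \<open>h > 0\<close>] by blast
  define K where "K = 2 * mse_v \<phi>"
  have "K \<ge> 0" using mse_v_nonneg[of \<phi>] by (simp add: K_def)
  define \<delta> where "\<delta> = min (1 / 5) (h / (5 * (K + 1)))"
  have "h / (5 * (K + 1)) > 0" using \<open>h > 0\<close> \<open>K \<ge> 0\<close> by simp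
  then have \<delta>: "\<delta> > 0" "5 * \<delta> \<le> 1" unfolding \<delta>_def by simp_all
  have "5 * \<delta> \<le> 5 * (h / (5 * (K + 1)))" unfolding \<delta>_def by (intro mult_left_mono) simp_all
  also have "\<dots> = h / (K + 1)" using \<open>K \<ge> 0\<close> by (simp add: divide_simps)
  finally have "5 * \<delta> \<le> h / (K + 1)" .
  have K\<delta>: "K * (5 * \<delta>) \<le> h"
  proof -
    have "K * (5 * \<delta>) \<le> (K + 1) * (h / (K + 1))"
      using \<delta> \<open>5 * \<delta> \<le> h / (K + 1)\<close> \<open>K \<ge> 0\<close> by (intro mult_mono) auto
    then show ?thesis using \<open>K \<ge> 0\<close> by simp
  qed
  have "r + h < r + 3 * h" using \<open>h > 0\<close> by simp
  obtain p where "p \<in> M" and p: "\<forall>a\<in>M. (le_val M e \<psi> (\<rho>(x := a)) \<le> r + h \<longrightarrow> e a p \<le> \<delta>) \<and>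
      (r + 3 * h \<le> le_val M e \<psi> (\<rho>(x := a)) \<longrightarrow> 0 < e a p)"
    using Le_excision_separates[OF exc \<rho> \<open>r + h < r + 3 * h\<close> \<delta>(1), of \<psi> x] by (elim bexE)
  obtain b where b: "b \<in> M" "d p b \<le> 4 * \<delta>" "\<forall>a\<in>M. e a p \<le> \<delta> \<longrightarrow> (a, b) \<in> E"
    using Le_excision_thickening[OF exc \<open>p \<in> M\<close> \<delta>(1)] by (elim bexE conjE)
  have "(c, b) \<in> E" if c: "c \<in> M" "?F c \<le> r" for c
  proof -
    have "le_val M e \<psi> (\<rho>(x := c)) \<le> r + h"
      using \<psi>[OF valuation_upd[OF \<rho> c(1), of x]] c(2) by linarith
    then have "e c p \<le> \<delta>" using bspec[OF p c(1)] by (elim conjE mp)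
    then show ?thesis using bspec[OF b(3) c(1)] by (rule rev_mp)
  qed
  moreover have "?F c < s" if c: "c \<in> M" "(c, b) \<in> E" for c
  proof -
    \<comment> \<open>Members of \<open>b\<close> have \<open>e\<close>-value at most \<open>4 * \<delta>\<close> at \<open>p\<close>; the bound \<open>5 * \<delta>\<close> makes this strict.\<close>
    have "e c b = 0" using c b(1) e_eq_0_iff by blast
    then have "e c p < 5 * \<delta>" using e_diff_le_d[OF \<open>p \<in> M\<close> b(1) c(1)] b(2) \<delta> by linarith
    then obtain a where a: "(a, p) \<in> E" "d c a < 5 * \<delta>"
      using e_less_witness[OF c(1) \<open>p \<in> M\<close>] \<delta>(2) by blast
    then have "a \<in> M" using E_sub by auto
    have "\<not> 0 < e a p" using e_eq_0_iff[OF \<open>a \<in> M\<close> \<open>p \<in> M\<close>] a(1) by simp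
    then have "le_val M e \<psi> (\<rho>(x := a)) < r + 3 * h" using bspec[OF p \<open>a \<in> M\<close>] by linarith
    then have "?F a < r + 4 * h" using \<psi>[OF valuation_upd[OF \<rho> \<open>a \<in> M\<close>, of x]] by linarith
    moreover have "\<bar>?F c - ?F a\<bar> \<le> K * d c a"
      unfolding K_def by (rule mse_val_lipschitz_upd[OF \<rho> c(1) \<open>a \<in> M\<close>])
    moreover have "K * d c a \<le> K * (5 * \<delta>)" using a(2) \<open>K \<ge> 0\<close> by (intro mult_left_mono) auto
    ultimately show "?F c < s" using K\<delta> s \<open>h > 0\<close> by linarith
  qed
  ultimately show "\<exists>b\<in>M. \<forall>c\<in>M. (?F c \<le> r \<longrightarrow> (c, b) \<in> E) \<and> ((c, b) \<in> E \<longrightarrow> ?F c < s)"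
    using b(1) by blast
qed

lemma mse_model_iff_Le_excision: "mse_model M d E \<longleftrightarrow> Le_excision M e"
  using metric_set_structure mse_excision_imp_Le_excision Le_excision_imp_mse_excision
  unfolding mse_model_def by blast

end

theorem proposition5p7:
  shows "(\<forall>(M :: 'a set) e.
            Le_structure M e \<and> H_extensional M e \<and>
            Metric_space M (d_of M e) \<and> Metric_space.mcomplete M (d_of M e) \<longrightarrow>
            (mse_model M (d_of M e) (E_of M e) \<longleftrightarrow> Le_excision M e)) \<and>
         (\<forall>(M :: 'a set) d E.
            mse_model M d E \<longrightarrow>
            Le_structure M (e_of d E) \<and> H_extensional M (e_of d E) \<and>
            Le_excision M (e_of d E) \<and>
            (\<forall>x\<in>M. \<forall>y\<in>M. d_of M (e_of d E) x y = d x y) \<and>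
            E_of M (e_of d E) = E)"
proof (intro conjI allI impI)
  fix M :: "'a set" and e
  assume "Le_structure M e \<and> H_extensional M e \<and>
            Metric_space M (d_of M e) \<and> Metric_space.mcomplete M (d_of M e)"
  then interpret membership_structure M "d_of M e" "E_of M e" e
    by (intro H_extensional_imp_membership_structure) auto
  show "mse_model M (d_of M e) (E_of M e) \<longleftrightarrow> Le_excision M e"
    by (rule mse_model_iff_Le_excision)
next
  fix M :: "'a set" and d E
  assume model: "mse_model M d E"
  then interpret membership_structure M d E "e_of d E"
    by (intro metric_set_structure_imp_membership_structure) (simp add: mse_model_def)
  show "Le_structure M (e_of d E)" by (rule Le_structure)
  show "H_extensional M (e_of d E)" by (rule H_extensional)
  show "Le_excision M (e_of d E)" using model by (simp add: mse_model_iff_Le_excision)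
  show "\<forall>x\<in>M. \<forall>y\<in>M. d_of M (e_of d E) x y = d x y" by (simp add: d_of_e_of)
  show "E_of M (e_of d E) = E" using E_sub e_eq_0_iff by (auto simp: E_of_def)
qed

end
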